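(* Let $v=\nabla\mu$ be the gradient of a scalar field $\mu$ on a neighbourhood of $\overline\Omega$, with $v$ of class $C^{1,1}$, and let $T_t$ be the flow of $v$. Let $k\ge1$ be such that $\lambda_{k-1}(0)<\lambda_k(0)<\lambda_{k+1}(0)$ (with $\lambda_0(0)=-\infty$), let $\phi=u_k(0)$, and put $\dot A=\dot A_0(\phi,\phi)$, $\ddot A=\ddot A_0(\phi,\phi)$, $\dot B=\dot B_0(\phi,\phi)$, $\ddot B=\ddot B_0(\phi,\phi)$. With $$H=\nabla^2\mu,\qquad K=\nabla^2(|\nabla\mu|^2)$$ (Hessian matrices), it holds that $$\dot A=\int_\Omega\bigl(-2H+(\mathrm{tr}\,H)E\bigr)[\nabla\phi,\nabla\phi]\,dx,$$ $$\ddot A=\int_\Omega\Bigl(6H^2-K-4(\mathrm{tr}\,H)H+\bigl((\mathrm{tr}\,H)^2+\tfrac12\mathrm{tr}\,K-H:H\bigr)E\Bigr)[\nabla\phi,\nabla\phi]\,dx,$$ $$\dot B=\int_\Omega(\mathrm{tr}\,H)\phi^2\,dx,\qquad \ddot B=\int_\Omega\bigl((\mathrm{tr}\,H)^2+\tfrac12\mathrm{tr}\,K-H:H\bigr)\phi^2\,dx.$$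
   Context: $\Omega\subset\mathbb{R}^n$, $n\ge2$, is a bounded Lipschitz domain whose boundary is divided into disjoint relatively open sets $\gamma_0,\gamma_1$ with $\overline{\gamma_0}\cup\overline{\gamma_1}=\partial\Omega$ and $\overline{\gamma_0}\cap\overline{\gamma_1}=\emptyset$. Let $X=L^2(\Omega)$ and $V=\{w\in H^1(\Omega): w|_{\gamma_0}=0\}$ (trace sense). Dynamical deformation: for $|t|\ll1$, $T_t:\Omega\to\Omega_t=T_t(\Omega)$ is defined by $T_tx=X(t)$, where $X(\cdot)$ solves $dX/dt=v(X)$, $X(0)=x$. Put $a_t=\det DT_t$ and $Q_t=(DT_t)^{-1}\bigl((DT_t)^{-1}\bigr)^T$, $DT_t$ being the Jacobi matrix, and $$A_t(u,w)=\int_\Omega Q_t[\nabla u,\nabla w]\,a_t\,dx\ (u,w\in V),\qquad B_t(u,w)=\int_\Omega uw\,a_t\,dx\ (u,w\in X).$$ At $t=0$ set $$\dot A_0(u,w)=\int_\Omega\partial_t\bigl(Q_t[\nabla u,\nabla w]a_t\bigr)\big|_{t=0}dx,\quad \ddot A_0(u,w)=\int_\Omega\partial_t^2\bigl(Q_t[\nabla u,\nabla w]a_t\bigr)\big|_{t=0}dx,$$ $$\dot B_0(u,w)=\int_\Omega uw\,\partial_ta_t|_{t=0}\,dx,\quad \ddot B_0(u,w)=\int_\Omega uw\,\partial_t^2a_t|_{t=0}\,dx,$$ with $t$-derivatives taken for (almost every) fixed $x\in\Omega$. $\lambda_1(t)\le\lambda_2(t)\le\cdots$ are the eigenvalues (with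 multiplicity) of: $u\in V$, $B_t(u,u)=1$, $A_t(u,w)=\lambda B_t(u,w)$ for all $w\in V$, with $B_t$-orthonormal eigenfunctions $u_1(t),u_2(t),\dots$. Notation: $G[\xi,\eta]=\xi^TG\eta$ for a matrix $G$; $E$ is the unit matrix; $G:F=\sum_{i,j}g_{ij}f_{ij}$, so $H:H=\sum_{i,j}h_{ij}^2$. Second derivatives of $|\nabla\mu|^2$ are understood almost everywhere. *)

theory Defs
  imports "HOL-Analysis.Analysis"
begin

text \<open>Functions on a domain are total functions on the ambient space; only their values on the
  domain, up to Lebesgue null sets, matter.\<close>

definition grad :: "(real^'n \<Rightarrow> real) \<Rightarrow> real^'n \<Rightarrow> real^'n" where
  "grad f x = (\<chi> i. frechet_derivative f (at x) (axis i 1))"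

definition hessian :: "(real^'n \<Rightarrow> real) \<Rightarrow> real^'n \<Rightarrow> real^'n^'n" where
  "hessian f x = jacobian (grad f) (at x)"

definition bil :: "real^'n^'n \<Rightarrow> real^'n \<Rightarrow> real^'n \<Rightarrow> real" where
  "bil G \<xi> \<eta> = \<xi> \<bullet> (G *v \<eta>)"

definition frob :: "real^'n^'n \<Rightarrow> real^'n^'n \<Rightarrow> real" where
  "frob G F = (\<Sum>i\<in>UNIV. \<Sum>j\<in>UNIV. G $ i $ j * F $ i $ j)"

text \<open>The Lipschitz condition on the derivative is local; on an unspecified neighbourhood of a
  compact set this amounts to the global one, as the neighbourhood may be shrunk.\<close>

definition C11_on :: "(real^'n) set \<Rightarrow> (real^'n \<Rightarrow> real^'n) \<Rightarrow> bool" where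
  "C11_on U v \<longleftrightarrow> v differentiable_on U \<and>
     (\<forall>x\<in>U. \<exists>e>0. \<exists>L. ball x e \<subseteq> U \<and> L-lipschitz_on (ball x e) (\<lambda>y. jacobian v (at y)))"

text \<open>Near each boundary point the domain is the part of a ball above a Lipschitz graph over
  the hyperplane orthogonal to some unit vector \<open>e\<close>.\<close>

definition bounded_lipschitz_domain :: "(real^'n) set \<Rightarrow> bool" where
  "bounded_lipschitz_domain \<Omega> \<longleftrightarrow> open \<Omega> \<and> connected \<Omega> \<and> \<Omega> \<noteq> {} \<and> bounded \<Omega> \<and>
     (\<forall>x\<in>frontier \<Omega>. \<exists>r>0. \<exists>e g L. norm e = 1 \<and> L-lipschitz_on {z. z \<bullet> e = 0} g \<and>
        \<Omega> \<inter> ball x r = {y \<in> ball x r. g (y - (y \<bullet> e) *\<^sub>R e) < y \<bullet> e})"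

subsection \<open>Sobolev space and trace\<close>

primrec Ck :: "nat \<Rightarrow> (real^'n \<Rightarrow> real) \<Rightarrow> bool" where
  "Ck 0 f \<longleftrightarrow> continuous_on UNIV f"
| "Ck (Suc k) f \<longleftrightarrow> f differentiable_on UNIV \<and> (\<forall>i. Ck k (\<lambda>x. grad f x $ i))"

definition smooth :: "(real^'n \<Rightarrow> real) \<Rightarrow> bool" where
  "smooth f \<longleftrightarrow> (\<forall>k. Ck k f)"

definition test_function :: "(real^'n) set \<Rightarrow> (real^'n \<Rightarrow> real) \<Rightarrow> bool" where
  "test_function \<Omega> \<psi> \<longleftrightarrow> smooth \<psi> \<and> compact (closure {x. \<psi> x \<noteq> 0}) \<and> closure {x. \<psi> x \<noteq> 0} \<subseteq> \<Omega>"

definition L2 :: "(real^'n) set \<Rightarrow> (real^'n \<Rightarrow> 'b::{real_normed_vector, second_countable_topology}) set"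
  where "L2 \<Omega> = {f. f \<in> borel_measurable (lebesgue_on \<Omega>) \<and> integrable (lebesgue_on \<Omega>) (\<lambda>x. (norm (f x))\<^sup>2)}"

definition is_weak_grad :: "(real^'n) set \<Rightarrow> (real^'n \<Rightarrow> real) \<Rightarrow> (real^'n \<Rightarrow> real^'n) \<Rightarrow> bool" where
  "is_weak_grad \<Omega> u G \<longleftrightarrow> G \<in> L2 \<Omega> \<and>
     (\<forall>\<psi>. test_function \<Omega> \<psi> \<longrightarrow> (\<forall>i.
        (LINT x|lebesgue_on \<Omega>. u x * grad \<psi> x $ i) = - (LINT x|lebesgue_on \<Omega>. G x $ i * \<psi> x)))"

definition H1 :: "(real^'n) set \<Rightarrow> (real^'n \<Rightarrow> real) set" where
  "H1 \<Omega> = {u \<in> L2 \<Omega>. \<exists>G. is_weak_grad \<Omega> u G}"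

text \<open>Weak gradients are unique up to null sets, so the choice of representative is immaterial.\<close>

definition weak_grad :: "(real^'n) set \<Rightarrow> (real^'n \<Rightarrow> real) \<Rightarrow> real^'n \<Rightarrow> real^'n" where
  "weak_grad \<Omega> u = (SOME G. is_weak_grad \<Omega> u G)"

text \<open>Hausdorff measure of dimension \<open>d \<ge> 1\<close> (with \<open>0 ^ 0 = 1\<close> the case \<open>d = 0\<close> would
  count empty covering sets), normalised to agree with surface area.\<close>

definition hausdorff_content :: "nat \<Rightarrow> real \<Rightarrow> 'a::euclidean_space set \<Rightarrow> ennreal" where
  "hausdorff_content d \<delta> A =
     (INF C \<in> {C :: nat \<Rightarrow> 'a set. A \<subseteq> (\<Union>i. C i) \<and> (\<forall>i. bounded (C i) \<and> diameter (C i) \<le> \<delta>)}.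
        \<Sum>i. ennreal (unit_ball_vol (real d) * (diameter (C i) / 2) ^ d))"

definition hausdorff_measure :: "nat \<Rightarrow> 'a::euclidean_space measure" where
  "hausdorff_measure d =
     measure_of UNIV (sets borel) (\<lambda>A. SUP \<delta>\<in>{0<..}. hausdorff_content d \<delta> A)"

definition surface_measure :: "(real^'n) set \<Rightarrow> (real^'n) measure" where
  "surface_measure \<Omega> = restrict_space (hausdorff_measure (CARD('n) - 1)) (frontier \<Omega>)"

text \<open>The trace operator as the continuous extension, from functions smooth up to the boundary
  (dense in \<open>H1 \<Omega>\<close> for Lipschitz domains), of the restriction to the boundary.\<close>

definition has_trace :: "(real^'n) set \<Rightarrow> (real^'n \<Rightarrow> real) \<Rightarrow> (real^'n \<Rightarrow> real) \<Rightarrow> bool" where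
  "has_trace \<Omega> u g \<longleftrightarrow>
     g \<in> borel_measurable (surface_measure \<Omega>) \<and> integrable (surface_measure \<Omega>) (\<lambda>x. (g x)\<^sup>2) \<and>
     (\<exists>w :: nat \<Rightarrow> real^'n \<Rightarrow> real. (\<forall>m. smooth (w m)) \<and>
        (\<lambda>m. \<integral>\<^sup>+x. ennreal ((w m x - u x)\<^sup>2 + (norm (grad (w m) x - weak_grad \<Omega> u x))\<^sup>2) \<partial>lebesgue_on \<Omega>)
          \<longlonglongrightarrow> 0 \<and>
        (\<lambda>m. \<integral>\<^sup>+x. ennreal ((w m x - g x)\<^sup>2) \<partial>surface_measure \<Omega>) \<longlonglongrightarrow> 0)"

definition V_space :: "(real^'n) set \<Rightarrow> (real^'n) set \<Rightarrow> (real^'n \<Rightarrow> real) set" where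
  "V_space \<Omega> \<gamma>\<^sub>0 =
     {w \<in> H1 \<Omega>. \<exists>g. has_trace \<Omega> w g \<and> (AE x in surface_measure \<Omega>. x \<in> \<gamma>\<^sub>0 \<longrightarrow> g x = 0)}"

subsection \<open>Flow and transported forms\<close>

definition is_flow :: "(real^'n \<Rightarrow> real^'n) \<Rightarrow> (real^'n) set \<Rightarrow> (real^'n) set \<Rightarrow> real
    \<Rightarrow> (real \<Rightarrow> real^'n \<Rightarrow> real^'n) \<Rightarrow> bool" where
  "is_flow v U \<Omega> \<delta> T \<longleftrightarrow> (\<forall>x\<in>\<Omega>. T 0 x = x \<and>
     (\<forall>t. \<bar>t\<bar> < \<delta> \<longrightarrow> T t x \<in> U \<and> ((\<lambda>s. T s x) has_vector_derivative v (T t x)) (at t)))"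

definition Jac :: "(real \<Rightarrow> real^'n \<Rightarrow> real^'n) \<Rightarrow> real \<Rightarrow> real^'n \<Rightarrow> real" where
  "Jac T t x = det (jacobian (T t) (at x))"

definition Qmat :: "(real \<Rightarrow> real^'n \<Rightarrow> real^'n) \<Rightarrow> real \<Rightarrow> real^'n \<Rightarrow> real^'n^'n" where
  "Qmat T t x =
     matrix_inv (jacobian (T t) (at x)) ** transpose (matrix_inv (jacobian (T t) (at x)))"

definition A_dens where
  "A_dens \<Omega> T u w t x = bil (Qmat T t x) (weak_grad \<Omega> u x) (weak_grad \<Omega> w x) * Jac T t x"

definition A_form where
  "A_form \<Omega> T t u w = (LINT x|lebesgue_on \<Omega>. A_dens \<Omega> T u w t x)"

definition B_form where
  "B_form \<Omega> T t u w = (LINT x|lebesgue_on \<Omega>. u x * w x * Jac T t x)"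

text \<open>For a \<open>C11\<close> field the second \<open>t\<close>-derivatives at 0 exist for almost every \<open>x\<close> only; the
  arbitrary values of \<open>deriv\<close> elsewhere lie over a null set. The same applies to the Hessian of
  a function whose gradient is merely Lipschitz.\<close>

definition A_dot where
  "A_dot \<Omega> T u w = (LINT x|lebesgue_on \<Omega>. deriv (\<lambda>t. A_dens \<Omega> T u w t x) 0)"

definition A_ddot where
  "A_ddot \<Omega> T u w = (LINT x|lebesgue_on \<Omega>. (deriv ^^ 2) (\<lambda>t. A_dens \<Omega> T u w t x) 0)"

definition B_dot where
  "B_dot \<Omega> T u w = (LINT x|lebesgue_on \<Omega>. u x * w x * deriv (\<lambda>t. Jac T t x) 0)"

definition B_ddot where
  "B_ddot \<Omega> T u w = (LINT x|lebesgue_on \<Omega>. u x * w x * (deriv ^^ 2) (\<lambda>t. Jac T t x) 0)"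

text \<open>\<open>lam 1 \<le> lam 2 \<le> \<dots>\<close> lists all eigenvalues according to multiplicity (index 0 is
  unused): the \<open>u j\<close> are orthonormal eigenfunctions and, for every \<open>l\<close>, those with
  \<open>lam j = l\<close> span the space of all solutions for \<open>l\<close>.\<close>

definition eigen_system :: "(real^'n) set \<Rightarrow> (real^'n) set \<Rightarrow> (real \<Rightarrow> real^'n \<Rightarrow> real^'n) \<Rightarrow> real
    \<Rightarrow> (nat \<Rightarrow> real) \<Rightarrow> (nat \<Rightarrow> real^'n \<Rightarrow> real) \<Rightarrow> bool" where
  "eigen_system \<Omega> \<gamma>\<^sub>0 T t lam u \<longleftrightarrow>
     (\<forall>i\<ge>1. lam i \<le> lam (Suc i)) \<and>
     (\<forall>i\<ge>1. u i \<in> V_space \<Omega> \<gamma>\<^sub>0) \<and>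
     (\<forall>i\<ge>1. \<forall>j\<ge>1. B_form \<Omega> T t (u i) (u j) = (if i = j then 1 else 0)) \<and>
     (\<forall>i\<ge>1. \<forall>w \<in> V_space \<Omega> \<gamma>\<^sub>0. A_form \<Omega> T t (u i) w = lam i * B_form \<Omega> T t (u i) w) \<and>
     (\<forall>l. finite {j. 1 \<le> j \<and> lam j = l}) \<and>
     (\<forall>l. \<forall>y \<in> V_space \<Omega> \<gamma>\<^sub>0.
        (\<forall>w \<in> V_space \<Omega> \<gamma>\<^sub>0. A_form \<Omega> T t y w = l * B_form \<Omega> T t y w) \<longrightarrow>
        (\<exists>c. AE x in lebesgue_on \<Omega>. y x = (\<Sum>j\<in>{j. 1 \<le> j \<and> lam j = l}. c j * u j x)))"

end

theory Submission
  imports Defs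
begin

text \<open>Each of the four identities equates two integrals over \<open>\<Omega>\<close>, and the integrands already agree at
  almost every point; the proof is a computation at one point \<open>x\<close>, together with the theorem that
  almost every point admits it.

  At a fixed \<open>x\<close> put \<open>J t = DT\<^sub>t x\<close> and \<open>A t = Dv (T\<^sub>t x)\<close>. Differentiating the flow equation in
  the initial point gives \<open>J' = A J\<close> with \<open>J 0\<close> the unit matrix. Hence \<open>det J\<close> has derivative
  \<open>tr A det J\<close>, and \<open>p = J\<^sup>-\<^sup>T \<xi>\<close> satisfies \<open>p' = - A p\<close>, because \<open>A\<close> is a Hessian and so symmetric. As
  \<open>Q\<^sub>t[\<xi>, \<xi>] a\<^sub>t\<close> is \<open>|p|\<^sup>2 det J\<close>, its first two derivatives at \<open>0\<close> are polynomials in \<open>H = A 0\<close> and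
  \<open>A' 0\<close>, the derivative of \<open>H\<close> in direction \<open>v x\<close> (\<open>transported_densities_derivatives\<close>). On the
  other hand \<open>\<nabla>|\<nabla>\<mu>|\<^sup>2 = 2 H v\<close>, so that \<open>K = 2 (A' 0 + H\<^sup>2)\<close>; here the derivative of \<open>H\<close> enters once
  contracted with \<open>v\<close> and once in direction \<open>v\<close>, and the two agree because third derivatives of \<open>\<mu>\<close>
  commute (\<open>hessian_norm_gradient_squared\<close>). Eliminating \<open>A' 0 = K / 2 - H\<^sup>2\<close> yields the formulas
  (\<open>pointwise_variation\<close>).

  Two analytic facts carry this. The Hessian \<open>H\<close> has to be differentiable at \<open>x\<close>; it is locally
  Lipschitz, so this holds almost everywhere by \<open>Rademacher\<close>. On the line, the upper and lower
  derivatives of a monotone function cannot differ on a set of positive measure, by two Vitali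
  coverings; Fubini transfers this to directional derivatives, integration over boxes shows these to
  be additive in the direction almost everywhere, and compactness of the sphere turns rational
  directions into a total derivative. Moreover \<open>T\<^sub>t\<close> has to be differentiable at \<open>x\<close> with \<open>J' = A J\<close>
  (\<open>flow_differentiable\<close>): for short times the difference quotients of the flow are Cauchy because
  they solve the linear equation up to small errors, and the quadratic remainder of \<open>v\<close>, available
  since \<open>Dv\<close> is Lipschitz, shows that their limit is the derivative.\<close>

section \<open>Almost everywhere differentiability of Lipschitz functions on the line\<close>

definition dquot :: "('a::real_vector \<Rightarrow> real) \<Rightarrow> 'a \<Rightarrow> 'a \<Rightarrow> real \<Rightarrow> real" where
  "dquot f e x h = (f (x + h *\<^sub>R e) - f x) / h"

text \<open>For bounded difference quotients, the directional derivative fails to exist at \<open>x\<close> exactly if \<open>x\<close>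
  lies in such a set for some rational \<open>p < q\<close>. Splitting the exceptional set in this way keeps every
  piece Borel.\<close>

definition oscillation_set :: "('a::real_vector \<Rightarrow> real) \<Rightarrow> 'a \<Rightarrow> real \<Rightarrow> real \<Rightarrow> 'a set" where
  "oscillation_set f e p q =
     {x. (\<exists>\<^sub>F h in at 0. dquot f e x h < p) \<and> (\<exists>\<^sub>F h in at 0. q < dquot f e x h)}"

text \<open>The Vitali covering theorem for intervals that merely contain the points to be covered: an interval
  is a closed ball around its midpoint, and the covering theorem does not ask the points to be
  centres.\<close>

lemma Vitali_intervals:
  fixes E :: "real set"
  assumes "open W" "E \<subseteq> W"
    and fine: "\<And>x d. x \<in> E \<Longrightarrow> d > 0 \<Longrightarrow> \<exists>a b. a < b \<and> x \<in> {a..b} \<and> b - a < d \<and> R a b"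
  obtains C where "countable C" "\<And>a b. (a, b) \<in> C \<Longrightarrow> a < b \<and> {a..b} \<subseteq> W \<and> R a b"
    "disjoint_family_on (\<lambda>(a, b). {a..b}) C" "negligible (E - (\<Union>(a, b)\<in>C. {a..b}))"
proof -
  define K where "K = {(a::real, b). a < b \<and> {a..b} \<subseteq> W \<and> R a b}"
  define c r where "c = (\<lambda>(a::real, b). (a + b) / 2)" and "r = (\<lambda>(a::real, b). (b - a) / 2)"
  have ball: "cball (c i) (r i) = (\<lambda>(a, b). {a..b}) i" for i
    unfolding c_def r_def cball_eq_atLeastAtMost by (auto simp: field_simps split: prod.splits)
  have 1: "0 < r i" if "i \<in> K" for i
    using that by (auto simp: K_def r_def)
  have 2: "\<exists>i. i \<in> K \<and> x \<in> cball (c i) (r i) \<and> r i < d" if x: "x \<in> E" and d: "0 < d" for x d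
  proof -
    obtain \<epsilon> where \<epsilon>: "\<epsilon> > 0" "ball x \<epsilon> \<subseteq> W"
      using assms(1,2) x by (meson open_contains_ball subsetD)
    obtain a b where ab: "a < b" "x \<in> {a..b}" "b - a < min d \<epsilon>" "R a b"
      using fine[OF x, of "min d \<epsilon>"] d \<epsilon> by auto
    have "{a..b} \<subseteq> ball x \<epsilon>"
      using ab by (auto simp: dist_real_def)
    with ab \<epsilon> have "(a, b) \<in> K" by (auto simp: K_def)
    moreover have "r (a, b) < d" using ab by (auto simp: r_def)
    ultimately show ?thesis
      using ab(2) by (intro exI[of _ "(a, b)"]) (auto simp: ball)
  qed
  show ?thesis
  proof (rule Vitali_covering_theorem_cballs[of K r E c])
    show "0 < r i" if "i \<in> K" for i using that by (rule 1)
    show "\<exists>i. i \<in> K \<and> x \<in> cball (c i) (r i) \<and> r i < d" if "x \<in> E" "0 < d" for x d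
      using that by (rule 2)
    fix C assume C: "countable C" "C \<subseteq> K"
      "pairwise (\<lambda>i j. disjnt (cball (c i) (r i)) (cball (c j) (r j))) C"
      "negligible (E - (\<Union>i\<in>C. cball (c i) (r i)))"
    show ?thesis
    proof (rule that[OF C(1)])
      show "a < b \<and> {a..b} \<subseteq> W \<and> R a b" if "(a, b) \<in> C" for a b
        using that C(2) by (auto simp: K_def)
      show "disjoint_family_on (\<lambda>(a, b). {a..b}) C"
        using C(3) unfolding ball pairwise_def disjoint_family_on_def disjnt_def by blast
      show "negligible (E - (\<Union>(a, b)\<in>C. {a..b}))"
        using C(4) unfolding ball .
    qed
  qed
qed

text \<open>Let \<open>\<nu>\<close> be the Stieltjes measure of \<open>F\<close>. Cover \<open>E\<close> by disjoint intervals of slope at most \<open>p\<close> inside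
  an open set \<open>W\<close> of almost the same measure, and then, inside these, by disjoint intervals of slope
  at least \<open>q\<close>. Comparing the \<open>\<nu>\<close>-measures of the two unions gives \<open>q |E| \<le> p |W|\<close>, which
  forces \<open>|E| = 0\<close> when \<open>W\<close> shrinks to \<open>E\<close>.\<close>

lemma monotone_slope_gap_null:
  fixes F :: "real \<Rightarrow> real"
  assumes mono: "\<And>x y. x \<le> y \<Longrightarrow> F x \<le> F y" and cont: "continuous_on UNIV F"
    and E: "E \<in> sets borel" "bounded E" and pq: "0 \<le> p" "p < q"
    and low: "\<And>x d. x \<in> E \<Longrightarrow> d > 0 \<Longrightarrow> \<exists>a b. a < b \<and> x \<in> {a..b} \<and> b - a < d \<and> F b - F a \<le> p * (b - a)"
    and high: "\<And>x d. x \<in> E \<Longrightarrow> d > 0 \<Longrightarrow> \<exists>a b. a < b \<and> x \<in> {a..b} \<and> b - a < d \<and> q * (b - a) \<le> F b - F a"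
  shows "negligible E"
proof -
  let ?\<nu> = "interval_measure F"
  have fin: "emeasure lborel E < \<infinity>"
    using E(2) by (rule emeasure_bounded_finite)
  have Icc: "emeasure lborel {a..b} = ennreal (b - a)" "emeasure ?\<nu> {a..b} = ennreal (F b - F a)"
    if "a \<le> b" for a b
    using that emeasure_interval_measure_Icc[OF that mono cont] by auto
  \<comment> \<open>The chain \<open>q |E| \<le> q \<Sum>|D| \<le> \<nu> (\<Union>D) \<le> \<nu> (\<Union>C) \<le> p \<Sum>|C| \<le> p |W|\<close>.\<close>
  have key: "ennreal q * emeasure lborel E \<le> ennreal p * (emeasure lborel E + ennreal \<epsilon>)"
    if "\<epsilon> > 0" for \<epsilon>
  proof -
    \<comment> \<open>Outer regularity: \<open>W\<close> exceeds \<open>E\<close> by at most \<open>\<epsilon>\<close>.\<close>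
    obtain W where W: "open W" "E \<subseteq> W" "emeasure lborel (W - E) < \<epsilon>"
      using outer_regular_lborel[OF E(1) \<open>\<epsilon> > 0\<close>] by blast
    have "emeasure lborel W = emeasure lborel E + emeasure lborel (W - E)"
      using W E by (subst plus_emeasure) (auto simp: Un_absorb1 intro: arg_cong[where f="emeasure lborel"])
    then have W_le: "emeasure lborel W \<le> emeasure lborel E + \<epsilon>"
      using W(3) by (simp add: add_left_mono)
    obtain C where C: "countable C"
        "\<And>a b. (a, b) \<in> C \<Longrightarrow> a < b \<and> {a..b} \<subseteq> W \<and> F b - F a \<le> p * (b - a)"
        "disjoint_family_on (\<lambda>(a, b). {a..b}) C" "negligible (E - (\<Union>(a, b)\<in>C. {a..b}))"
      using Vitali_intervals[OF W(1,2), where R = "\<lambda>a b. F b - F a \<le> p * (b - a)"] low by metis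
    \<comment> \<open>Open intervals, so that the second covering can be taken inside them; only countably many end points are lost.\<close>
    define W' where "W' = (\<Union>(a, b)\<in>C. {a<..<b})"
    have W': "open W'" unfolding W'_def by auto
    obtain D where D: "countable D"
        "\<And>a b. (a, b) \<in> D \<Longrightarrow> a < b \<and> {a..b} \<subseteq> W' \<and> q * (b - a) \<le> F b - F a"
        "disjoint_family_on (\<lambda>(a, b). {a..b}) D" "negligible (E \<inter> W' - (\<Union>(a, b)\<in>D. {a..b}))"
      using Vitali_intervals[OF W', where R = "\<lambda>a b. q * (b - a) \<le> F b - F a" and E = "E \<inter> W'"] high
      by (metis Int_iff inf_le2)
    have bC: "(\<Union>(a, b)\<in>C. {a..b}) \<in> sets borel" using C(1) by (intro sets.countable_UN'') auto
    have bD: "(\<Union>(a, b)\<in>D. {a..b}) \<in> sets borel" using D(1) by (intro sets.countable_UN'') auto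
    define N where "N = (E - (\<Union>(a, b)\<in>C. {a..b})) \<union> (E \<inter> W' - (\<Union>(a, b)\<in>D. {a..b}))
        \<union> (\<Union>(a, b)\<in>C. {a, b})"
    have "N \<in> sets borel"
    proof -
      have "(\<Union>(a, b)\<in>C. {a, b}) \<in> sets borel"
        using C(1) by (intro sets.countable_UN'') auto
      then show ?thesis
        unfolding N_def using W' E(1) bC bD by (intro sets.Un sets.Diff sets.Int) auto
    qed
    moreover have "negligible N"
      unfolding N_def using C(1) C(4) D(4)
      by (intro negligible_Un) (auto simp: negligible_iff_null_sets
          intro!: null_sets_completionI countable_imp_null_set_lborel)
    ultimately have N: "N \<in> null_sets lborel"
      by (simp add: negligible_iff_null_sets null_sets_completion_iff)
    have "E \<subseteq> (\<Union>(a, b)\<in>D. {a..b}) \<union> N"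
      unfolding N_def W'_def by (force simp: less_le)
    then have "emeasure lborel E \<le> emeasure lborel ((\<Union>(a, b)\<in>D. {a..b}) \<union> N)"
      using bD N by (intro emeasure_mono) auto
    also have "\<dots> = emeasure lborel (\<Union>(a, b)\<in>D. {a..b})"
      using N bD by (intro emeasure_Un_null_set) auto
    also have "\<dots> = (\<integral>\<^sup>+i. emeasure lborel (case i of (a, b) \<Rightarrow> {a..b}) \<partial>count_space D)"
      by (rule emeasure_UN_countable[OF _ D(1) D(3)]) auto
    finally have "ennreal q * emeasure lborel E \<le>
        ennreal q * (\<integral>\<^sup>+i. emeasure lborel (case i of (a, b) \<Rightarrow> {a..b}) \<partial>count_space D)"
      by (rule mult_left_mono) auto
    also have "\<dots> = (\<integral>\<^sup>+i. ennreal q * emeasure lborel (case i of (a, b) \<Rightarrow> {a..b}) \<partial>count_space D)"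
      by (rule nn_integral_cmult[symmetric]) auto
    also have "\<dots> \<le> (\<integral>\<^sup>+i. emeasure ?\<nu> (case i of (a, b) \<Rightarrow> {a..b}) \<partial>count_space D)"
    proof (intro nn_integral_mono, clarsimp simp del: emeasure_lborel_Icc)
      fix a b assume "(a, b) \<in> D"
      from D(2)[OF this] show "ennreal q * emeasure lborel {a..b} \<le> emeasure ?\<nu> {a..b}"
        using pq by (simp add: Icc ennreal_mult[symmetric] ennreal_leI)
    qed
    also have "\<dots> = emeasure ?\<nu> (\<Union>(a, b)\<in>D. {a..b})"
      by (rule emeasure_UN_countable[OF _ D(1) D(3), symmetric]) auto
    also have "\<dots> \<le> emeasure ?\<nu> (\<Union>(a, b)\<in>C. {a..b})"
    proof (rule emeasure_mono)
      have "W' \<subseteq> (\<Union>(a, b)\<in>C. {a..b})" unfolding W'_def by (rule UN_mono) (auto split: prod.splits)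
      with D(2) show "(\<Union>(a, b)\<in>D. {a..b}) \<subseteq> (\<Union>(a, b)\<in>C. {a..b})" by fast
    qed (use bC in auto)
    also have "\<dots> = (\<integral>\<^sup>+i. emeasure ?\<nu> (case i of (a, b) \<Rightarrow> {a..b}) \<partial>count_space C)"
      by (rule emeasure_UN_countable[OF _ C(1) C(3)]) auto
    also have "\<dots> \<le> (\<integral>\<^sup>+i. ennreal p * emeasure lborel (case i of (a, b) \<Rightarrow> {a..b}) \<partial>count_space C)"
    proof (intro nn_integral_mono, clarsimp simp del: emeasure_lborel_Icc)
      fix a b assume "(a, b) \<in> C"
      from C(2)[OF this] show "emeasure ?\<nu> {a..b} \<le> ennreal p * emeasure lborel {a..b}"
        using pq by (simp add: Icc ennreal_mult[symmetric] ennreal_leI)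
    qed
    also have "\<dots> = ennreal p * (\<integral>\<^sup>+i. emeasure lborel (case i of (a, b) \<Rightarrow> {a..b}) \<partial>count_space C)"
      by (rule nn_integral_cmult) auto
    also have "\<dots> = ennreal p * emeasure lborel (\<Union>(a, b)\<in>C. {a..b})"
      by (subst emeasure_UN_countable[OF _ C(1) C(3)]) auto
    also have "\<dots> \<le> ennreal p * emeasure lborel W"
      using C(2) W(1) by (intro mult_left_mono emeasure_mono) fastforce+
    also have "\<dots> \<le> ennreal p * (emeasure lborel E + \<epsilon>)"
      using W_le by (rule mult_left_mono) auto
    finally show ?thesis .
  qed
  define m where "m = measure lborel E"
  have em: "emeasure lborel E = ennreal m"
    unfolding m_def using fin by (simp add: emeasure_eq_ennreal_measure top.not_eq_extremum)
  have m0: "m \<ge> 0" by (simp add: m_def)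
  have "q * m \<le> p * m + \<epsilon>" if "\<epsilon> > 0" for \<epsilon>
  proof -
    have "ennreal (q * m) \<le> ennreal (p * (m + \<epsilon> / (p + 1)))"
      using key[of "\<epsilon> / (p + 1)"] that pq m0 unfolding em
      by (simp add: ennreal_mult[symmetric] ennreal_plus[symmetric] del: ennreal_plus)
    then have "q * m \<le> p * (m + \<epsilon> / (p + 1))"
      using pq m0 that by (subst (asm) ennreal_le_iff) auto
    also have "\<dots> = p * m + p / (p + 1) * \<epsilon>" by (simp add: distrib_left)
    also have "\<dots> \<le> p * m + 1 * \<epsilon>"
      using pq that by (intro add_left_mono mult_right_mono) (auto simp: field_simps)
    finally show ?thesis by simp
  qed
  then have "q * m \<le> p * m" by (rule field_le_epsilon)
  then have "m = 0" using pq m0 by (metis linorder_not_le mult_less_cancel_right order_le_less)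
  with em E show ?thesis
    by (simp add: negligible_iff_null_sets null_sets_completion_iff null_setsI)
qed

lemma bounded_without_oscillation_tendsto:
  fixes g :: "'b \<Rightarrow> real"
  assumes F: "F \<noteq> bot" and bd: "eventually (\<lambda>x. \<bar>g x\<bar> \<le> M) F"
    and no: "\<And>p q. p \<in> \<rat> \<Longrightarrow> q \<in> \<rat> \<Longrightarrow> p < q \<Longrightarrow> frequently (\<lambda>x. g x < p) F \<Longrightarrow> frequently (\<lambda>x. q < g x) F \<Longrightarrow> False"
  shows "\<exists>l. (g \<longlongrightarrow> l) F"
proof -
  \<comment> \<open>The limit inferior, as the supremum of the eventual lower bounds.\<close>
  define S where "S = {p. eventually (\<lambda>x. p \<le> g x) F}"
  have "eventually (\<lambda>x. - M \<le> g x) F" using bd by eventually_elim auto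
  then have ne: "- M \<in> S" by (simp add: S_def)
  have ub: "p \<le> M" if "p \<in> S" for p
  proof -
    have "eventually (\<lambda>x. p \<le> g x) F" using that by (simp add: S_def)
    with bd have "eventually (\<lambda>x. p \<le> M) F" by eventually_elim auto
    with F show ?thesis by simp
  qed
  have bdd: "bdd_above S" using ub by (rule bdd_aboveI)
  show ?thesis
  proof (intro exI order_tendstoI)
    fix a assume "a < Sup S"
    then obtain p where "p \<in> S" "a < p" using less_cSup_iff[OF _ bdd] ne by blast
    then show "eventually (\<lambda>x. a < g x) F"
      by (auto simp: S_def elim!: eventually_mono)
  next
    fix a assume "Sup S < a"
    then obtain p where p: "p \<in> \<rat>" "Sup S < p" "p < a" using Rats_dense_in_real by blast
    then obtain q where q: "q \<in> \<rat>" "p < q" "q < a" using Rats_dense_in_real by blast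
    have "p \<notin> S" using cSup_upper[OF _ bdd, of p] p by auto
    then have "frequently (\<lambda>x. g x < p) F" by (simp add: S_def frequently_def not_less)
    then have "\<not> frequently (\<lambda>x. q < g x) F" using no[OF p(1) q(1,2)] by blast
    then have "eventually (\<lambda>x. g x \<le> q) F" by (simp add: frequently_def not_less)
    then show "eventually (\<lambda>x. g x < a) F" by eventually_elim (use q in auto)
  qed
qed

lemma frequently_at_0_real:
  "(\<exists>\<^sub>F h in at (0::real). P h) \<longleftrightarrow> (\<forall>n. \<exists>h. h \<noteq> 0 \<and> \<bar>h\<bar> < 1 / real (Suc n) \<and> P h)"
proof -
  have "(\<exists>\<^sub>F h in at (0::real). P h) \<longleftrightarrow> (\<forall>d>0. \<exists>h. h \<noteq> 0 \<and> \<bar>h\<bar> < d \<and> P h)"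
    unfolding frequently_at by (auto simp: dist_real_def)
  also have "\<dots> \<longleftrightarrow> (\<forall>n. \<exists>h. h \<noteq> 0 \<and> \<bar>h\<bar> < 1 / real (Suc n) \<and> P h)"
  proof (intro iffI allI impI)
    fix d :: real assume H: "\<forall>n. \<exists>h. h \<noteq> 0 \<and> \<bar>h\<bar> < 1 / real (Suc n) \<and> P h" and "d > 0"
    obtain n where "1 / real (Suc n) < d" using nat_approx_posE[OF \<open>d > 0\<close>] by blast
    with H[rule_format, of n] show "\<exists>h. h \<noteq> 0 \<and> \<bar>h\<bar> < d \<and> P h"
      by (meson less_trans)
  qed simp
  finally show ?thesis .
qed

lemma oscillation_set_borel:
  fixes f :: "'a::euclidean_space \<Rightarrow> real"
  assumes "continuous_on UNIV f"
  shows "oscillation_set f e p q \<in> sets borel"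
proof -
  have c: "continuous_on UNIV (\<lambda>x. dquot f e x h)" if "h \<noteq> 0" for h
    unfolding dquot_def
    by (intro continuous_intros continuous_on_compose2[OF assms]) (use that in auto)
  have "oscillation_set f e p q =
     (\<Inter>n. \<Union>h\<in>{h. h \<noteq> 0 \<and> \<bar>h\<bar> < 1 / real (Suc n)}. {x. dquot f e x h < p}) \<inter>
     (\<Inter>n. \<Union>h\<in>{h. h \<noteq> 0 \<and> \<bar>h\<bar> < 1 / real (Suc n)}. {x. q < dquot f e x h})"
    unfolding oscillation_set_def frequently_at_0_real by auto
  moreover have "open (\<Union>h\<in>{h. h \<noteq> 0 \<and> \<bar>h\<bar> < 1 / real (Suc n)}. {x. dquot f e x h < p})"
    "open (\<Union>h\<in>{h. h \<noteq> 0 \<and> \<bar>h\<bar> < 1 / real (Suc n)}. {x. q < dquot f e x h})" for n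
    by (auto intro!: open_UN open_Collect_less c continuous_on_const)
  ultimately show ?thesis
    by (auto intro!: sets.Int sets.countable_INT'' borel_open)
qed

lemma Lipschitz_dquot_bound:
  fixes f :: "'a::real_normed_vector \<Rightarrow> real"
  assumes "L-lipschitz_on UNIV f"
  shows "\<bar>dquot f e x h\<bar> \<le> L * norm e"
proof (cases "h = 0")
  case False
  have "\<bar>f (x + h *\<^sub>R e) - f x\<bar> \<le> L * (\<bar>h\<bar> * norm e)"
    using lipschitz_onD[OF assms, of "x + h *\<^sub>R e" x] by (simp add: dist_norm)
  then show ?thesis
    using False by (simp add: dquot_def abs_divide divide_le_eq mult_ac)
qed (use lipschitz_on_nonneg[OF assms] in \<open>auto simp: dquot_def\<close>)

text \<open>Adding \<open>L s\<close> makes the function monotone and shifts all slopes by \<open>L\<close>; intersecting with balls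
  provides the finite measure that the comparison of slopes needs.\<close>

lemma Lipschitz_real_oscillation_null:
  fixes f :: "real \<Rightarrow> real"
  assumes lip: "L-lipschitz_on UNIV f" and pq: "p < q"
  shows "negligible (oscillation_set f 1 p q)"
proof -
  define F where "F = (\<lambda>s. f s + L * s)"
  have bd: "\<bar>dquot f 1 x h\<bar> \<le> L" for x h
    using Lipschitz_dquot_bound[OF lip, of 1] by simp
  have mono: "F x \<le> F y" if "x \<le> y" for x y
    using lipschitz_onD[OF lip, of x y] that by (auto simp: F_def dist_real_def algebra_simps)
  have contf: "continuous_on UNIV f" using lip by (rule lipschitz_on_continuous_on)
  then have cont: "continuous_on UNIV F" unfolding F_def by (intro continuous_intros)
  have slope: "\<exists>a b. a < b \<and> x \<in> {a..b} \<and> b - a = \<bar>h\<bar> \<and> F b - F a = (dquot f 1 x h + L) * (b - a)"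
    if "h \<noteq> 0" for x h
  proof (cases "h > 0")
    case True
    then show ?thesis
      by (intro exI[of _ x] exI[of _ "x + h"]) (auto simp: dquot_def F_def field_simps)
  next
    case False
    with that show ?thesis
      by (intro exI[of _ "x + h"] exI[of _ x]) (auto simp: dquot_def F_def field_simps)
  qed
  have null: "negligible (oscillation_set f 1 p q \<inter> ball 0 (real n))" (is "negligible ?E") for n
  proof (cases "p + L \<ge> 0")
    case False
    have "oscillation_set f 1 p q = {}"
    proof (rule ccontr)
      assume "oscillation_set f 1 p q \<noteq> {}"
      then obtain x where "\<exists>\<^sub>F h in at 0. dquot f 1 x h < p"
        by (auto simp: oscillation_set_def)
      then obtain h where "dquot f 1 x h < p" using frequently_ex by blast
      with bd[of x h] False show False by auto
    qed
    then show ?thesis by simp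
  next
    case True
    show ?thesis
    proof (rule monotone_slope_gap_null[OF mono cont _ _ True, of _ "q + L"])
      show "?E \<in> sets borel" using oscillation_set_borel[OF contf] by auto
      show "bounded ?E" by (meson bounded_Int bounded_ball)
      show "p + L < q + L" using pq by simp
      fix x d :: real assume x: "x \<in> ?E" and d: "d > 0"
      from x have fr: "\<exists>\<^sub>F h in at 0. dquot f 1 x h < p" "\<exists>\<^sub>F h in at 0. q < dquot f 1 x h"
        by (auto simp: oscillation_set_def)
      from fr(1) d obtain h where h: "h \<noteq> 0" "\<bar>h\<bar> < d" "dquot f 1 x h < p"
        unfolding frequently_at by (auto simp: dist_real_def)
      from slope[OF h(1), of x] obtain a b where
        ab: "a < b" "x \<in> {a..b}" "b - a = \<bar>h\<bar>" "F b - F a = (dquot f 1 x h + L) * (b - a)" by blast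
      have "F b - F a \<le> (p + L) * (b - a)"
        unfolding ab(4) using h ab(1) by (intro mult_right_mono) auto
      with ab h show "\<exists>a b. a < b \<and> x \<in> {a..b} \<and> b - a < d \<and> F b - F a \<le> (p + L) * (b - a)"
        by metis
      from fr(2) d obtain h where h: "h \<noteq> 0" "\<bar>h\<bar> < d" "q < dquot f 1 x h"
        unfolding frequently_at by (auto simp: dist_real_def)
      from slope[OF h(1), of x] obtain a b where
        ab: "a < b" "x \<in> {a..b}" "b - a = \<bar>h\<bar>" "F b - F a = (dquot f 1 x h + L) * (b - a)" by blast
      have "(q + L) * (b - a) \<le> F b - F a"
        unfolding ab(4) using h ab(1) by (intro mult_right_mono) auto
      with ab h show "\<exists>a b. a < b \<and> x \<in> {a..b} \<and> b - a < d \<and> (q + L) * (b - a) \<le> F b - F a"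
        by metis
    qed
  qed
  have "oscillation_set f 1 p q = (\<Union>n. oscillation_set f 1 p q \<inter> ball 0 (real n))"
    by (auto simp: dist_real_def intro: reals_Archimedean2)
  moreover have "negligible (\<Union>n. oscillation_set f 1 p q \<inter> ball 0 (real n))"
    using null by (intro negligible_countable_Union) auto
  ultimately show ?thesis by simp
qed

section \<open>Rademacher's theorem\<close>

text \<open>Fubini for \<open>{(x, s). x + s e \<in> N}\<close>: its sections in \<open>s\<close> are null by assumption, while its sections
  in \<open>x\<close> are translates of \<open>N\<close>. Integrating over translations avoids a choice of coordinates adapted
  to \<open>e\<close>.\<close>

lemma null_if_null_on_parallel_lines:
  fixes N :: "'a::euclidean_space set"
  assumes N: "N \<in> sets borel" and lines: "\<And>x. negligible {s. x + s *\<^sub>R e \<in> N}"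
  shows "negligible N"
proof -
  define G where "G = {z :: 'a \<times> real. fst z + snd z *\<^sub>R e \<in> N}"
  have "(\<lambda>z :: 'a \<times> real. fst z + snd z *\<^sub>R e) \<in> borel_measurable borel"
    by (intro borel_measurable_continuous_onI continuous_intros)
  from measurable_sets[OF this N] have "G \<in> sets borel"
    by (simp add: G_def vimage_def)
  then have G: "G \<in> sets (lborel \<Otimes>\<^sub>M lborel)"
    by (simp only: lborel_prod sets_lborel)
  have sec: "emeasure lborel {s. x + s *\<^sub>R e \<in> N} = 0" for x
  proof -
    have "(\<lambda>s::real. x + s *\<^sub>R e) \<in> borel_measurable borel"
      by (intro borel_measurable_continuous_onI continuous_intros)
    from measurable_sets[OF this N] have "{s. x + s *\<^sub>R e \<in> N} \<in> sets borel"
      by (simp add: vimage_def)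
    with lines[of x] show ?thesis
      by (simp add: negligible_iff_null_sets null_sets_completion_iff null_sets_def)
  qed
  have tr: "emeasure lborel {x. x + s *\<^sub>R e \<in> N} = emeasure lborel N" for s
  proof -
    have "emeasure lborel N = emeasure (distr lborel borel ((+) (s *\<^sub>R e))) N"
      by (simp only: lborel_distr_plus)
    also have "\<dots> = emeasure lborel {x. x + s *\<^sub>R e \<in> N}"
      using N by (subst emeasure_distr) (auto simp: vimage_def add.commute)
    finally show ?thesis by simp
  qed
  have "emeasure (lborel \<Otimes>\<^sub>M lborel) G = (\<integral>\<^sup>+x. emeasure lborel (Pair x -` G) \<partial>lborel)"
    using G by (rule lborel.emeasure_pair_measure_alt)
  also have "\<dots> = 0"
    using sec by (simp add: G_def vimage_def)
  finally have "0 = (\<integral>\<^sup>+s. emeasure lborel ((\<lambda>x. (x, s)) -` G) \<partial>lborel)"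
    using lborel_pair.emeasure_pair_measure_alt2[OF G] by simp
  also have "\<dots> = (\<integral>\<^sup>+s. emeasure lborel N \<partial>(lborel :: real measure))"
    using tr by (simp add: G_def vimage_def)
  finally have "emeasure lborel N = 0"
    by (simp add: ennreal_mult_eq_top_iff)
  with N show ?thesis
    by (simp add: negligible_iff_null_sets null_sets_completion_iff null_setsI)
qed

text \<open>The restriction of \<open>f\<close> to a line parallel to \<open>e\<close> is Lipschitz, and its difference quotients are those
  of \<open>f\<close> in direction \<open>e\<close>.\<close>

lemma Lipschitz_oscillation_null:
  fixes f :: "'a::euclidean_space \<Rightarrow> real"
  assumes lip: "L-lipschitz_on UNIV f" and pq: "p < q"
  shows "negligible (oscillation_set f e p q)"
proof (rule null_if_null_on_parallel_lines)
  show "oscillation_set f e p q \<in> sets borel"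
    using lip by (intro oscillation_set_borel lipschitz_on_continuous_on)
  fix x
  define g where "g = (\<lambda>s. f (x + s *\<^sub>R e))"
  have "(L * norm e)-lipschitz_on UNIV g"
  proof (rule lipschitz_onI)
    fix s t :: real
    have "dist (g s) (g t) \<le> L * dist (x + s *\<^sub>R e) (x + t *\<^sub>R e)"
      unfolding g_def by (rule lipschitz_onD[OF lip]) auto
    also have "dist (x + s *\<^sub>R e) (x + t *\<^sub>R e) = norm e * dist s t"
      by (simp add: dist_norm scaleR_left_diff_distrib[symmetric])
    finally show "dist (g s) (g t) \<le> L * norm e * dist s t" by (simp add: mult_ac)
  qed (use lipschitz_on_nonneg[OF lip] in auto)
  from Lipschitz_real_oscillation_null[OF this pq]
  have "negligible (oscillation_set g 1 p q)" .
  moreover have "dquot g 1 s h = dquot f e (x + s *\<^sub>R e) h" for s h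
    by (simp add: dquot_def g_def algebra_simps)
  then have "oscillation_set g 1 p q = {s. x + s *\<^sub>R e \<in> oscillation_set f e p q}"
    by (auto simp: oscillation_set_def)
  ultimately show "negligible {s. x + s *\<^sub>R e \<in> oscillation_set f e p q}" by simp
qed

lemma Lipschitz_directional_limit_AE:
  fixes f :: "'a::euclidean_space \<Rightarrow> real"
  assumes lip: "L-lipschitz_on UNIV f"
  shows "AE x in lborel. \<exists>l. (dquot f e x \<longlongrightarrow> l) (at 0)"
proof -
  define N where "N = (\<Union>p\<in>\<rat>. \<Union>q\<in>\<rat> \<inter> {p<..}. oscillation_set f e p q)"
  have "oscillation_set f e p q \<in> null_sets lborel" if "q \<in> \<rat> \<inter> {p<..}" for p q
    using that Lipschitz_oscillation_null[OF lip, of p q e]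
      oscillation_set_borel[OF lipschitz_on_continuous_on[OF lip], of e p q]
    by (simp add: negligible_iff_null_sets null_sets_completion_iff)
  then have "N \<in> null_sets lborel"
    unfolding N_def by (intro null_sets_UN' countable_rat countable_Int1)
  moreover have "\<exists>l. (dquot f e x \<longlongrightarrow> l) (at 0)" if "x \<notin> N" for x
  proof (rule bounded_without_oscillation_tendsto[where M = "L * norm e"])
    show "\<forall>\<^sub>F h in at 0. \<bar>dquot f e x h\<bar> \<le> L * norm e"
      using Lipschitz_dquot_bound[OF lip] by simp
  qed (use that in \<open>auto simp: N_def oscillation_set_def\<close>)
  ultimately show ?thesis by (intro AE_I') auto
qed

lemma lborel_integral_translation:
  fixes F :: "'a::euclidean_space \<Rightarrow> real"
  assumes "F \<in> borel_measurable borel"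
  shows "(LINT x|lborel. F (c + x)) = (LINT x|lborel. F x)"
proof -
  have "(LINT x|lborel. F x) = (LINT x|distr lborel borel ((+) c). F x)"
    by (simp only: lborel_distr_plus)
  also have "\<dots> = (LINT x|lborel. F (c + x))"
    using assms by (intro integral_distr) auto
  finally show ?thesis by simp
qed

text \<open>The density \<open>1 + g / c\<close> is nonnegative and has the volume of the box as its integral over every
  box, so it defines Lebesgue measure and must be \<open>1\<close> almost everywhere.\<close>

lemma AE_zero_if_box_integrals_zero:
  fixes g :: "'a::euclidean_space \<Rightarrow> real"
  assumes meas: "g \<in> borel_measurable borel" and bd: "\<And>x. \<bar>g x\<bar> \<le> c" and c: "c > 0"
    and zero: "\<And>l u. (LINT x|lborel. indicator (box l u) x * g x) = 0"
  shows "AE x in lborel. g x = 0"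
proof -
  define \<phi> where "\<phi> = (\<lambda>x. 1 + g x / c)"
  have [measurable]: "g \<in> borel_measurable borel" by (rule meas)
  have \<phi>0: "0 \<le> \<phi> x" for x
    using bd[of x] c by (auto simp: \<phi>_def field_simps abs_le_iff)
  have m\<phi> [measurable]: "\<phi> \<in> borel_measurable borel" unfolding \<phi>_def by measurable
  have "lborel = density lborel (\<lambda>x. ennreal (\<phi> x))"
  proof (rule lborel_eqI)
    fix l u :: 'a assume lu: "\<And>b. b \<in> Basis \<Longrightarrow> l \<bullet> b \<le> u \<bullet> b"
    have fin: "emeasure lborel (box l u) < \<infinity>" by (rule emeasure_lborel_box_finite)
    have i1: "integrable lborel (indicator (box l u) :: 'a \<Rightarrow> real)"
      using fin by (intro integrable_real_indicator) auto
    have i2: "integrable lborel (\<lambda>x. indicator (box l u) x * g x)"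
      by (rule Bochner_Integration.integrable_bound[OF integrable_mult_right[OF i1, of c]])
        (use bd c in \<open>auto split: split_indicator simp: abs_le_iff\<close>)
    have eq: "indicator (box l u) x * \<phi> x = indicator (box l u) x + (indicator (box l u) x * g x) / c" for x
      by (simp add: \<phi>_def algebra_simps)
    have "emeasure (density lborel (\<lambda>x. ennreal (\<phi> x))) (box l u) =
        (\<integral>\<^sup>+x. ennreal (\<phi> x) * indicator (box l u) x \<partial>lborel)"
      by (rule emeasure_density) auto
    also have "\<dots> = (\<integral>\<^sup>+x. ennreal (indicator (box l u) x * \<phi> x) \<partial>lborel)"
      by (intro nn_integral_cong) (auto split: split_indicator)
    also have "\<dots> = ennreal (LINT x|lborel. indicator (box l u) x * \<phi> x)"
      proof (rule nn_integral_eq_integral)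
      show "integrable lborel (\<lambda>x. indicator (box l u) x * \<phi> x)"
        unfolding eq using i1 i2 by auto
      show "AE x in lborel. 0 \<le> indicator (box l u) x * \<phi> x"
        using \<phi>0 by (intro AE_I2 mult_nonneg_nonneg) auto
    qed
    also have "(LINT x|lborel. indicator (box l u) x * \<phi> x) = measure lborel (box l u)"
      unfolding eq using i1 i2 zero[of l u] by simp
    also have "ennreal (measure lborel (box l u)) = ennreal (\<Prod>b\<in>Basis. (u - l) \<bullet> b)"
      using lu by (simp add: measure_lborel_box_eq)
    finally show "emeasure (density lborel (\<lambda>x. ennreal (\<phi> x))) (box l u) = ennreal (\<Prod>b\<in>Basis. (u - l) \<bullet> b)" .
  qed simp
  then have "density lborel (\<lambda>x. ennreal (\<phi> x)) = density lborel (\<lambda>x. 1)"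
    by (simp add: density_1)
  then have "AE x in lborel. ennreal (\<phi> x) = 1"
    by (subst (asm) sigma_finite_measure.density_unique_iff[OF sigma_finite_lborel]) auto
  then show ?thesis
  proof eventually_elim
    case (elim x)
    then show ?case using c by (auto simp: \<phi>_def)
  qed
qed

lemma box_translation_indicator_tendsto_0:
  fixes e :: "'a::euclidean_space"
  shows "(\<lambda>n. LINT x|lborel. \<bar>indicator (box l u) (x - inverse (real (Suc n)) *\<^sub>R e) - indicator (box l u) x :: real\<bar>)
     \<longlonglongrightarrow> 0"
proof -
  let ?B = "box l u"
  obtain r where r: "?B \<subseteq> ball 0 r"
    using bounded_box bounded_subset_ballD by blast
  have tr: "(\<lambda>n. x - inverse (real (Suc n)) *\<^sub>R e) \<longlonglongrightarrow> x" for x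
  proof -
    have "(\<lambda>n. x - inverse (real (Suc n)) *\<^sub>R e) \<longlonglongrightarrow> x - 0 *\<^sub>R e"
      by (intro tendsto_intros LIMSEQ_inverse_real_of_nat)
    then show ?thesis by simp
  qed
  have "(\<lambda>n. LINT x|lborel. \<bar>indicator ?B (x - inverse (real (Suc n)) *\<^sub>R e) - indicator ?B x :: real\<bar>)
     \<longlonglongrightarrow> (LINT x|(lborel :: 'a measure). (0::real))"
  proof (rule integral_dominated_convergence[where w = "indicator (ball (0::'a) (r + norm e))" and f = "\<lambda>_. 0"
      and s = "\<lambda>n x. \<bar>indicator ?B (x - inverse (real (Suc n)) *\<^sub>R e) - indicator ?B x\<bar>"])
    show "integrable lborel (indicator (ball (0::'a) (r + norm e)) :: 'a \<Rightarrow> real)"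
      by (intro integrable_real_indicator emeasure_bounded_finite) auto
    have "frontier ?B \<in> null_sets lborel"
      using negligible_convex_frontier[OF convex_box(2)[of l u]] unfolding negligible_iff_null_sets
      by (simp add: null_sets_completion_iff borel_closed)
    then have "AE x in lborel. x \<notin> frontier ?B" by (rule AE_not_in)
    then show "AE x in lborel. (\<lambda>n. \<bar>indicator ?B (x - inverse (real (Suc n)) *\<^sub>R e) - indicator ?B x :: real\<bar>) \<longlonglongrightarrow> 0"
    proof eventually_elim
      case (elim x)
      have "eventually (\<lambda>n. (x - inverse (real (Suc n)) *\<^sub>R e \<in> ?B) = (x \<in> ?B)) sequentially"
      proof (cases "x \<in> ?B")
        case True
        from topological_tendstoD[OF tr open_box this] show ?thesis
          by eventually_elim (use True in auto)
      next
        case False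
        with elim have "x \<in> - closure ?B" by (auto simp: frontier_def interior_open[OF open_box])
        from topological_tendstoD[OF tr _ this] have
          "eventually (\<lambda>n. x - inverse (real (Suc n)) *\<^sub>R e \<in> - closure ?B) sequentially" by auto
        then show ?thesis
          by eventually_elim (use False closure_subset in auto)
      qed
      then show ?case
        by (intro tendsto_eventually) (auto elim!: eventually_mono simp: indicator_def)
    qed
    show "AE x in lborel. norm \<bar>indicator ?B (x - inverse (real (Suc n)) *\<^sub>R e) - indicator ?B x :: real\<bar>
        \<le> indicator (ball 0 (r + norm e)) x" for n
    proof (intro AE_I2)
      fix x
      have "inverse (real (Suc n)) * norm e \<le> 1 * norm e"
        by (intro mult_right_mono) (auto simp: field_simps)
      then have "norm x < r + norm e" if "x - inverse (real (Suc n)) *\<^sub>R e \<in> ?B"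
        using that r norm_triangle_sub[of x "inverse (real (Suc n)) *\<^sub>R e"] by (force simp: subset_iff)
      moreover have "norm x < r + norm e" if "x \<in> ?B"
      proof -
        have "norm x < r" using that r by auto
        then show ?thesis using norm_ge_zero[of e] by linarith
      qed
      ultimately show "norm \<bar>indicator ?B (x - inverse (real (Suc n)) *\<^sub>R e) - indicator ?B x :: real\<bar>
        \<le> indicator (ball 0 (r + norm e)) x"
        by (auto simp: indicator_def)
    qed
  qed auto
  then show ?thesis by simp
qed

text \<open>The defect of additivity of the difference quotients with step \<open>t\<close> is the \<open>e1\<close>-quotient at
  \<open>x + t e2\<close> minus the \<open>e1\<close>-quotient at \<open>x\<close>. Integrated over a box, the translation can be moved
  onto the box, and the result vanishes as \<open>t\<close> tends to \<open>0\<close> since the quotients are bounded. So the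
  limit defect integrates to zero over every box.\<close>

lemma Lipschitz_directional_limit_additive_AE:
  fixes f :: "'a::euclidean_space \<Rightarrow> real"
  assumes lip: "L-lipschitz_on UNIV f"
  shows "AE x in lborel. \<forall>a b c. (dquot f e1 x \<longlongrightarrow> a) (at 0) \<longrightarrow> (dquot f e2 x \<longlongrightarrow> b) (at 0) \<longrightarrow>
      (dquot f (e1 + e2) x \<longlongrightarrow> c) (at 0) \<longrightarrow> c = a + b"
proof -
  define t where "t = (\<lambda>n. inverse (real (Suc n)))"
  have t0: "t n > 0" for n by (simp add: t_def)
  have tlim: "filterlim t (at 0) sequentially"
    unfolding t_def using LIMSEQ_inverse_real_of_nat by (intro filterlim_atI) auto
  define gn where "gn = (\<lambda>n x. dquot f e1 (t n *\<^sub>R e2 + x) (t n) - dquot f e1 x (t n))"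
  have gn_eq: "gn n x = dquot f (e1 + e2) x (t n) - dquot f e1 x (t n) - dquot f e2 x (t n)" for n x
    using t0[of n] by (simp add: gn_def dquot_def divide_simps) (simp add: algebra_simps)
  define c where "c = 2 * (L * norm e1) + 1"
  have L0: "L \<ge> 0" using lipschitz_on_nonneg[OF lip] .
  have c: "c > 0" using L0 by (simp add: c_def add_nonneg_pos)
  have gnb: "\<bar>gn n x\<bar> \<le> c" for n x
    using Lipschitz_dquot_bound[OF lip, of e1 "t n *\<^sub>R e2 + x" "t n"]
      Lipschitz_dquot_bound[OF lip, of e1 x "t n"] unfolding gn_def c_def by linarith
  have contf: "continuous_on UNIV f" using lip by (rule lipschitz_on_continuous_on)
  have contd: "continuous_on UNIV (\<lambda>x. dquot f e x (t n))" for e n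
    unfolding dquot_def
    by (intro continuous_intros continuous_on_compose2[OF contf]) (use t0[of n] in auto)
  have md [measurable]: "(\<lambda>x. dquot f e x (t n)) \<in> borel_measurable borel" for e n
    using contd by (rule borel_measurable_continuous_onI)
  have mdt [measurable]: "(\<lambda>x. dquot f e (y + x) (t n)) \<in> borel_measurable borel" for e n y
    using measurable_compose[OF _ md, of "\<lambda>x. y + x"] by simp
  have mgn [measurable]: "gn n \<in> borel_measurable borel" for n
    unfolding gn_def by measurable
  \<comment> \<open>Truncation keeps \<open>g\<close> bounded also where the limit does not exist and \<open>lim\<close> is arbitrary.\<close>
  define g where "g = (\<lambda>x. max (- c) (min c (lim (\<lambda>n. gn n x))))"
  have mg [measurable]: "g \<in> borel_measurable borel"
    unfolding g_def by measurable
  have gb: "\<bar>g x\<bar> \<le> c" for x using c by (auto simp: g_def)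
  have ex: "AE x in lborel. \<exists>a b d. (dquot f e1 x \<longlongrightarrow> a) (at 0) \<and> (dquot f e2 x \<longlongrightarrow> b) (at 0) \<and>
      (dquot f (e1 + e2) x \<longlongrightarrow> d) (at 0)"
    using Lipschitz_directional_limit_AE[OF lip, of e1] Lipschitz_directional_limit_AE[OF lip, of e2]
      Lipschitz_directional_limit_AE[OF lip, of "e1 + e2"] by eventually_elim blast
  have glim': "(\<lambda>n. gn n x) \<longlonglongrightarrow> g x \<and> g x = d - a - b"
    if "(dquot f e1 x \<longlongrightarrow> a) (at 0)" "(dquot f e2 x \<longlongrightarrow> b) (at 0)" "(dquot f (e1 + e2) x \<longlongrightarrow> d) (at 0)"
    for x a b d
  proof -
    have lm: "(\<lambda>n. gn n x) \<longlonglongrightarrow> d - a - b"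
      unfolding gn_eq using that by (intro tendsto_diff filterlim_compose[OF _ tlim])
    then have "\<bar>d - a - b\<bar> \<le> c"
      using gnb by (intro LIMSEQ_le_const2[OF tendsto_rabs[OF lm]]) auto
    with lm show ?thesis unfolding g_def limI[OF lm] by (auto simp: abs_le_iff min_def max_def)
  qed
  have glim: "AE x in lborel. (\<lambda>n. gn n x) \<longlonglongrightarrow> g x"
    using ex by eventually_elim (use glim' in blast)
  have "(LINT x|lborel. indicator (box l u) x * g x) = 0" for l u
  proof (rule LIMSEQ_unique)
    let ?B = "box l u"
    let ?I = "indicator ?B :: 'a \<Rightarrow> real"
    have iB: "integrable lborel ?I" by (intro integrable_real_indicator emeasure_lborel_box_finite) auto
    show "(\<lambda>n. LINT x|lborel. ?I x * gn n x) \<longlonglongrightarrow> (LINT x|lborel. ?I x * g x)"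
    proof (rule integral_dominated_convergence[where w = "\<lambda>x. c * ?I x"])
      show "AE x in lborel. (\<lambda>n. ?I x * gn n x) \<longlonglongrightarrow> ?I x * g x"
        using glim by eventually_elim (intro tendsto_intros)
      show "AE x in lborel. norm (?I x * gn n x) \<le> c * ?I x" for n
        using gnb c by (intro AE_I2) (auto simp: indicator_def)
    qed (use iB in auto)
    have bound: "\<bar>LINT x|lborel. ?I x * gn n x\<bar> \<le>
        (L * norm e1) * (LINT x|lborel. \<bar>?I (x - t n *\<^sub>R e2) - ?I x\<bar>)" for n
    proof -
      let ?y = "t n *\<^sub>R e2"
      let ?h = "\<lambda>x. dquot f e1 x (t n)"
      have hb: "\<bar>?h x\<bar> \<le> L * norm e1" for x by (rule Lipschitz_dquot_bound[OF lip])
      have mI: "?I \<in> borel_measurable borel" by auto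
      have mI' [measurable]: "(\<lambda>x. ?I (x - ?y)) \<in> borel_measurable borel"
        using measurable_compose[OF _ mI, of "\<lambda>x. x - ?y"] by simp
      have iI': "integrable lborel (\<lambda>x. ?I (x - ?y))"
      proof -
        have "integrable (distr lborel borel ((+) (- ?y))) ?I" using iB by (simp only: lborel_distr_plus)
        then show ?thesis by (subst (asm) integrable_distr_eq) auto
      qed
      have bnd: "integrable lborel (\<lambda>x. J x * k x)"
        if "integrable lborel J" "k \<in> borel_measurable borel" "\<And>x. \<bar>k x\<bar> \<le> L * norm e1"
        for J k :: "'a \<Rightarrow> real"
      proof (rule Bochner_Integration.integrable_bound)
        show "integrable lborel (\<lambda>x. (L * norm e1) * J x)" using that(1) by simp
        have "J \<in> borel_measurable lborel" using that(1) by auto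
        then show "(\<lambda>x. J x * k x) \<in> borel_measurable lborel"
          using that(2) by (intro borel_measurable_times) auto
        show "AE x in lborel. norm (J x * k x) \<le> norm (L * norm e1 * J x)"
          using that(3) L0 by (intro AE_I2) (simp add: abs_mult mult.commute mult_left_mono)
      qed
      have "(LINT x|lborel. ?I x * ?h (?y + x)) = (LINT x|lborel. ?I ((?y + x) - ?y) * ?h (?y + x))"
        by simp
      also have "\<dots> = (LINT x|lborel. ?I (x - ?y) * ?h x)"
        by (rule lborel_integral_translation[where F = "\<lambda>x. ?I (x - ?y) * ?h x"]) measurable
      finally have sh: "(LINT x|lborel. ?I x * ?h (?y + x)) = (LINT x|lborel. ?I (x - ?y) * ?h x)" .
      have "(LINT x|lborel. ?I x * gn n x) = (LINT x|lborel. ?I x * ?h (?y + x)) - (LINT x|lborel. ?I x * ?h x)"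
        unfolding gn_def right_diff_distrib
        by (rule Bochner_Integration.integral_diff; rule bnd[OF iB]; (rule mdt md hb)?)
      also have "\<dots> = (LINT x|lborel. ?I (x - ?y) * ?h x - ?I x * ?h x)"
        unfolding sh
        by (rule Bochner_Integration.integral_diff[symmetric]; rule bnd; (rule iI' iB md hb)?)
      also have "\<dots> = (LINT x|lborel. (?I (x - ?y) - ?I x) * ?h x)"
        by (simp add: left_diff_distrib)
      finally have eq: "(LINT x|lborel. ?I x * gn n x) = (LINT x|lborel. (?I (x - ?y) - ?I x) * ?h x)" .
      have "\<bar>LINT x|lborel. (?I (x - ?y) - ?I x) * ?h x\<bar> \<le> (LINT x|lborel. \<bar>(?I (x - ?y) - ?I x) * ?h x\<bar>)"
        by (rule integral_abs_bound)
      also have "\<dots> \<le> (LINT x|lborel. (L * norm e1) * \<bar>?I (x - ?y) - ?I x\<bar>)"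
      proof (rule integral_mono)
        show "integrable lborel (\<lambda>x. \<bar>(?I (x - ?y) - ?I x) * ?h x\<bar>)"
          by (rule integrable_abs, rule bnd, rule Bochner_Integration.integrable_diff, rule iI', rule iB, rule md, rule hb)
        show "integrable lborel (\<lambda>x. (L * norm e1) * \<bar>?I (x - ?y) - ?I x\<bar>)"
          by (intro integrable_mult_right integrable_abs Bochner_Integration.integrable_diff iI' iB)
        show "\<bar>(?I (x - ?y) - ?I x) * ?h x\<bar> \<le> (L * norm e1) * \<bar>?I (x - ?y) - ?I x\<bar>" for x
          using mult_right_mono[OF hb[of x], of "\<bar>?I (x - ?y) - ?I x\<bar>"] by (simp add: abs_mult mult.commute)
      qed
      finally show ?thesis unfolding eq by simp
    qed
    have "(\<lambda>n. (L * norm e1) * (LINT x|lborel. \<bar>?I (x - t n *\<^sub>R e2) - ?I x\<bar>)) \<longlonglongrightarrow> (L * norm e1) * 0"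
      unfolding t_def by (intro tendsto_intros box_translation_indicator_tendsto_0)
    then have lim0: "(\<lambda>n. (L * norm e1) * (LINT x|lborel. \<bar>?I (x - t n *\<^sub>R e2) - ?I x\<bar>)) \<longlonglongrightarrow> 0"
      by (simp only: mult_zero_right)
    show "(\<lambda>n. LINT x|lborel. ?I x * gn n x) \<longlonglongrightarrow> 0"
      by (rule Lim_null_comparison[OF always_eventually lim0]) (simp only: real_norm_def bound HOL.simp_thms)
  qed
  from AE_zero_if_box_integrals_zero[OF mg gb c this]
  have "AE x in lborel. g x = 0" .
  then show ?thesis
  proof eventually_elim
    case (elim x)
    show ?case
    proof (intro allI impI)
      fix a b d
      assume "(dquot f e1 x \<longlongrightarrow> a) (at 0)" "(dquot f e2 x \<longlongrightarrow> b) (at 0)" "(dquot f (e1 + e2) x \<longlongrightarrow> d) (at 0)"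
      from glim'[OF this] elim show "d = a + b" by simp
    qed
  qed
qed

text \<open>Finitely many directions of \<open>Q\<close> form a net of the unit sphere; along them the quotients converge
  uniformly, and the Lipschitz bound controls the remaining directions.\<close>

lemma Lipschitz_dense_directional_imp_has_derivative:
  fixes f :: "'a::euclidean_space \<Rightarrow> real"
  assumes lip: "L-lipschitz_on UNIV f" and lin: "linear A" and dense: "closure Q = UNIV"
    and lim: "\<And>e. e \<in> Q \<Longrightarrow> (dquot f e x \<longlongrightarrow> A e) (at 0)"
  shows "(f has_derivative A) (at x)"
  unfolding has_derivative_at_alt
proof (intro conjI allI impI)
  show bl: "bounded_linear A" using lin by (simp add: linear_conv_bounded_linear)
  obtain B where B: "B > 0" "\<And>h. norm (A h) \<le> norm h * B"
    using bounded_linear.pos_bounded[OF bl] by blast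
  have L0: "L \<ge> 0" using lipschitz_on_nonneg[OF lip] .
  fix \<epsilon> :: real assume \<epsilon>: "\<epsilon> > 0"
  \<comment> \<open>A net of mesh \<open>\<eta>\<close> costs \<open>L \<eta>\<close> in \<open>f\<close> and \<open>B \<eta>\<close> in \<open>A\<close>, together \<open>\<epsilon> / 2\<close>.\<close>
  define \<eta> where "\<eta> = \<epsilon> / (2 * (L + B))"
  have \<eta>: "\<eta> > 0" "(L + B) * \<eta> = \<epsilon> / 2" proof -
    have "L + B > 0" using B(1) L0 by linarith
    then show "\<eta> > 0" using \<epsilon> by (simp add: \<eta>_def)
    have "k * (\<epsilon> / (2 * k)) = \<epsilon> / 2" if "k > 0" for k :: real using that by simp
    with \<open>L + B > 0\<close> show "(L + B) * \<eta> = \<epsilon> / 2" unfolding \<eta>_def by blast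
  qed
  have "sphere (0::'a) 1 \<subseteq> (\<Union>e\<in>Q. ball e \<eta>)"
  proof
    fix w :: 'a
    have "w \<in> closure Q" using dense by simp
    then obtain e where "e \<in> Q" "dist e w < \<eta>" using \<eta>(1) closure_approachable by blast
    then show "w \<in> (\<Union>e\<in>Q. ball e \<eta>)" by auto
  qed
  then obtain Z where Z: "Z \<subseteq> Q" "finite Z" "sphere (0::'a) 1 \<subseteq> (\<Union>e\<in>Z. ball e \<eta>)"
    using compactE_image[OF compact_sphere, of Q "\<lambda>e. ball e \<eta>"] by (metis open_ball)
  have "eventually (\<lambda>h. \<forall>e\<in>Z. dist (dquot f e x h) (A e) < \<epsilon> / 2) (at 0)"
    using Z \<epsilon> lim by (intro eventually_ball_finite ballI tendstoD) auto
  then obtain d where d: "d > 0"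
    "\<And>h e. h \<noteq> 0 \<Longrightarrow> \<bar>h\<bar> < d \<Longrightarrow> e \<in> Z \<Longrightarrow> \<bar>dquot f e x h - A e\<bar> < \<epsilon> / 2"
    unfolding eventually_at by (auto simp: dist_real_def)
  show "\<exists>d>0. \<forall>y. norm (y - x) < d \<longrightarrow> norm (f y - f x - A (y - x)) \<le> \<epsilon> * norm (y - x)"
  proof (intro exI[of _ d] conjI d(1) allI impI)
    fix y assume y: "norm (y - x) < d"
    show "norm (f y - f x - A (y - x)) \<le> \<epsilon> * norm (y - x)"
    proof (cases "y = x")
      case True then show ?thesis using linear_0[OF lin] by simp
    next
      case False
      define r where "r = norm (y - x)"
      define w where "w = (y - x) /\<^sub>R r"
      have r: "r > 0" "r < d" using False y by (auto simp: r_def)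
      have yw: "y = x + r *\<^sub>R w" using r by (simp add: w_def)
      have "w \<in> sphere 0 1" using r by (simp add: w_def r_def)
      with Z(3) obtain e where e: "e \<in> Z" "norm (e - w) < \<eta>" by (auto simp: dist_norm)
      have 1: "\<bar>f (x + r *\<^sub>R e) - f x - r * A e\<bar> \<le> r * (\<epsilon> / 2)"
      proof -
        have "f (x + r *\<^sub>R e) - f x - r * A e = r * (dquot f e x r - A e)"
          using r by (simp add: dquot_def field_simps)
        then show ?thesis using d(2)[of r e] r e(1) by (simp add: abs_mult)
      qed
      have 2: "\<bar>f y - f (x + r *\<^sub>R e)\<bar> \<le> L * (r * \<eta>)"
      proof -
        have "\<bar>f y - f (x + r *\<^sub>R e)\<bar> \<le> L * norm (y - (x + r *\<^sub>R e))"
          using lipschitz_onD[OF lip, of y "x + r *\<^sub>R e"] by (simp add: dist_norm)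
        also have "norm (y - (x + r *\<^sub>R e)) = r * norm (e - w)"
          using r unfolding yw by (simp add: scaleR_right_diff_distrib[symmetric] norm_minus_commute)
        also have "L * (r * norm (e - w)) \<le> L * (r * \<eta>)"
          using L0 r e(2) by (intro mult_left_mono) auto
        finally show ?thesis .
      qed
      have 3: "\<bar>r * A (e - w)\<bar> \<le> r * (\<eta> * B)"
      proof -
        have "\<bar>A (e - w)\<bar> \<le> norm (e - w) * B" using B(2)[of "e - w"] by simp
        also have "\<dots> \<le> \<eta> * B" using e(2) B(1) by (intro mult_right_mono) auto
        finally show ?thesis using r by (simp add: abs_mult)
      qed
      have "f y - f x - A (y - x) = (f (x + r *\<^sub>R e) - f x - r * A e) + (f y - f (x + r *\<^sub>R e)) + r * A (e - w)"
      proof -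
        have "A (y - x) = r * A w" using linear_scale[OF lin, of r w] unfolding yw by simp
        moreover have "r * A (e - w) = r * A e - r * A w"
          by (simp add: linear_diff[OF lin] right_diff_distrib)
        ultimately show ?thesis by simp
      qed
      then have "\<bar>f y - f x - A (y - x)\<bar> \<le> r * (\<epsilon> / 2) + L * (r * \<eta>) + r * (\<eta> * B)"
        using 1 2 3 by linarith
      also have "\<dots> = r * (\<epsilon> / 2) + r * ((L + B) * \<eta>)" by (simp add: algebra_simps)
      also have "\<dots> = \<epsilon> * r" unfolding \<eta>(2) by simp
      finally show ?thesis by (simp add: r_def)
    qed
  qed
qed

lemma dquot_scale_tendsto:
  assumes "(dquot f e x \<longlongrightarrow> l) (at 0)"
  shows "(dquot f (r *\<^sub>R e) x \<longlongrightarrow> r * l) (at 0)"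
proof (cases "r = 0")
  case True
  then show ?thesis by (simp add: dquot_def[abs_def])
next
  case False
  have "filterlim (\<lambda>h. r * h) (at 0) (at 0)"
    using False by (intro filterlim_atI) (auto intro!: tendsto_eq_intros simp: eventually_at_filter)
  from filterlim_compose[OF assms this] have "((\<lambda>h. r * dquot f e x (r * h)) \<longlongrightarrow> r * l) (at 0)"
    by (intro tendsto_intros)
  moreover have "dquot f (r *\<^sub>R e) x = (\<lambda>h. r * dquot f e x (r * h))"
    using False by (auto simp: dquot_def mult.commute)
  ultimately show ?thesis by simp
qed

text \<open>The vectors with rational coordinates are a countable dense set that is closed under addition. Off
  a null set, all directional derivatives along them exist and are additive, hence given by the linear
  map determined by the coordinate directions.\<close>

theorem Rademacher_Lipschitz:
  fixes f :: "'a::euclidean_space \<Rightarrow> real"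
  assumes lip: "L-lipschitz_on UNIV f"
  shows "AE x in lborel. f differentiable (at x)"
proof -
  define Q where "Q = {e :: 'a. \<forall>i\<in>Basis. e \<bullet> i \<in> \<rat>}"
  have "Q \<subseteq> (\<lambda>c. \<Sum>i\<in>Basis. c i *\<^sub>R i) ` (PiE Basis (\<lambda>_. \<rat>))"
  proof
    fix e assume "e \<in> Q"
    then have "restrict (\<lambda>i. e \<bullet> i) Basis \<in> PiE Basis (\<lambda>_. \<rat>)" by (auto simp: Q_def)
    moreover have "(\<Sum>i\<in>Basis. restrict (\<lambda>i. e \<bullet> i) Basis i *\<^sub>R i) = e"
      by (simp add: euclidean_representation)
    ultimately show "e \<in> (\<lambda>c. \<Sum>i\<in>Basis. c i *\<^sub>R i) ` (PiE Basis (\<lambda>_. \<rat>))"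
      by (intro image_eqI[where x = "restrict (\<lambda>i. e \<bullet> i) Basis"]) simp_all
  qed
  then have cQ: "countable Q"
    by (rule countable_subset) (intro countable_image countable_PiE finite_Basis countable_rat)
  have "(\<Union>c \<in> Basis \<rightarrow> \<rat>. {\<Sum>i :: 'a \<in> Basis. c i *\<^sub>R i}) \<subseteq> Q"
    by (auto simp: Q_def inner_sum_left inner_Basis if_distrib Pi_iff cong: if_cong)
  then have dense: "closure Q = UNIV"
    using closure_mono[of "\<Union>c \<in> Basis \<rightarrow> \<rat>. {\<Sum>i :: 'a \<in> Basis. c i *\<^sub>R i}" Q]
      unfolding closure_rational_coordinates by auto
  have "AE x in lborel. \<forall>e\<in>Q. \<exists>l. (dquot f e x \<longlongrightarrow> l) (at 0)"
    using cQ Lipschitz_directional_limit_AE[OF lip] by (subst AE_ball_countable) auto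
  moreover have "AE x in lborel. \<forall>e1\<in>Q. \<forall>e2\<in>Q. \<forall>a b c. (dquot f e1 x \<longlongrightarrow> a) (at 0) \<longrightarrow>
      (dquot f e2 x \<longlongrightarrow> b) (at 0) \<longrightarrow> (dquot f (e1 + e2) x \<longlongrightarrow> c) (at 0) \<longrightarrow> c = a + b"
    by (intro iffD2[OF AE_ball_countable[OF cQ]] ballI Lipschitz_directional_limit_additive_AE[OF lip])
  ultimately show ?thesis
  proof eventually_elim
    case (elim x)
    then obtain D where D: "\<And>e. e \<in> Q \<Longrightarrow> (dquot f e x \<longlongrightarrow> D e) (at 0)" by metis
    define A where "A = (\<lambda>h. \<Sum>i\<in>Basis. (h \<bullet> i) * D i)"
    have lin: "linear A"
      by (rule linearI) (simp_all add: A_def inner_add_left distrib_right sum.distrib sum_distrib_left mult.assoc)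
    have BQ: "r *\<^sub>R i \<in> Q" if "i \<in> Basis" "r \<in> \<rat>" for i r
      using that by (auto simp: Q_def inner_Basis)
    have part: "(\<Sum>i\<in>S. (e \<bullet> i) *\<^sub>R i) \<in> Q \<and> (dquot f (\<Sum>i\<in>S. (e \<bullet> i) *\<^sub>R i) x \<longlongrightarrow> (\<Sum>i\<in>S. (e \<bullet> i) * D i)) (at 0)"
      if "finite S" "S \<subseteq> Basis" "e \<in> Q" for S e
      using that
    proof (induction S rule: finite_induct)
      case empty
      then show ?case by (simp add: Q_def dquot_def[abs_def])
    next
      case (insert i S)
      have i: "i \<in> Basis" "e \<bullet> i \<in> \<rat>" using insert by (auto simp: Q_def)
      have 1: "(dquot f ((e \<bullet> i) *\<^sub>R i) x \<longlongrightarrow> (e \<bullet> i) * D i) (at 0)"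
        using D[of i] BQ[OF i(1), of 1] by (intro dquot_scale_tendsto) auto
      have 2: "(dquot f (\<Sum>i\<in>S. (e \<bullet> i) *\<^sub>R i) x \<longlongrightarrow> (\<Sum>i\<in>S. (e \<bullet> i) * D i)) (at 0)"
        "(\<Sum>i\<in>S. (e \<bullet> i) *\<^sub>R i) \<in> Q" using insert by auto
      have 3: "(e \<bullet> i) *\<^sub>R i + (\<Sum>i\<in>S. (e \<bullet> i) *\<^sub>R i) \<in> Q"
        using 2(2) BQ[OF i] by (auto simp: Q_def inner_add_left)
      have "D ((e \<bullet> i) *\<^sub>R i + (\<Sum>i\<in>S. (e \<bullet> i) *\<^sub>R i)) = (e \<bullet> i) * D i + (\<Sum>i\<in>S. (e \<bullet> i) * D i)"
        using elim(2) BQ[OF i] 2(2) 1 2(1) D[OF 3] by blast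
      with D[OF 3] 3 insert(1,2) show ?case by simp
    qed
    have "(dquot f e x \<longlongrightarrow> A e) (at 0)" if "e \<in> Q" for e
      using part[OF finite_Basis subset_refl that] by (simp add: euclidean_representation A_def)
    from Lipschitz_dense_directional_imp_has_derivative[OF lip lin dense this]
    show ?case by (rule differentiableI)
  qed
qed

text \<open>McShane's extension: the infimum of the cones \<open>f y + L dist x y\<close>.\<close>

lemma Lipschitz_extension_real:
  fixes f :: "'a::metric_space \<Rightarrow> real"
  assumes lip: "L-lipschitz_on S f"
  obtains F where "L-lipschitz_on UNIV F" "\<And>x. x \<in> S \<Longrightarrow> F x = f x"
proof (cases "S = {}")
  case True
  show ?thesis
    by (rule that[of "\<lambda>_. 0"]) (use True lipschitz_on_nonneg[OF lip] in \<open>auto intro: lipschitz_onI\<close>)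
next
  case False
  have L0: "L \<ge> 0" using lipschitz_on_nonneg[OF lip] .
  define F where "F = (\<lambda>x. INF y\<in>S. f y + L * dist x y)"
  have low: "f z - L * dist x z \<le> f y + L * dist x y" if "z \<in> S" "y \<in> S" for x y z
  proof -
    have "f z - f y \<le> L * dist z y" using lipschitz_onD[OF lip that] by (auto simp: dist_real_def)
    also have "\<dots> \<le> L * (dist x z + dist x y)"
      using L0 by (intro mult_left_mono) (metis dist_commute dist_triangle2)
    finally show ?thesis by (simp add: algebra_simps)
  qed
  have bdd: "bdd_below ((\<lambda>y. f y + L * dist x y) ` S)" for x
  proof -
    obtain z where "z \<in> S" using False by blast
    with low[of z] show ?thesis by (intro bdd_belowI2[where m = "f z - L * dist x z"]) auto
  qed
  have le: "F x \<le> F x' + L * dist x x'" for x x'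
  proof -
    have "F x - L * dist x x' \<le> F x'"
      unfolding F_def
    proof (rule cINF_greatest[OF False])
      fix y assume y: "y \<in> S"
      have "(INF y\<in>S. f y + L * dist x y) \<le> f y + L * dist x y" by (rule cINF_lower[OF bdd y])
      also have "L * dist x y \<le> L * (dist x x' + dist x' y)"
        using L0 by (intro mult_left_mono dist_triangle)
      finally show "(INF y\<in>S. f y + L * dist x y) - L * dist x x' \<le> f y + L * dist x' y"
        by (simp add: algebra_simps)
    qed
    then show ?thesis by simp
  qed
  show ?thesis
  proof (rule that[of F])
    show "L-lipschitz_on UNIV F"
    proof (rule lipschitz_onI[OF _ L0])
      fix x y show "dist (F x) (F y) \<le> L * dist x y"
        using le[of x y] le[of y x] by (simp add: dist_real_def dist_commute abs_le_iff)
    qed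
    fix x assume x: "x \<in> S"
    have "F x \<le> f x" using cINF_lower[OF bdd x, of x] by (simp add: F_def)
    moreover have "f x \<le> F x" unfolding F_def using low[OF x, of _ x] by (intro cINF_greatest[OF False]) auto
    ultimately show "F x = f x" by simp
  qed
qed

text \<open>Being negligible is a local property, and near each point every component of \<open>f\<close> coincides with a
  Lipschitz function on the whole space.\<close>

theorem Rademacher:
  fixes f :: "'a::euclidean_space \<Rightarrow> 'b::euclidean_space"
  assumes loc: "\<And>x. x \<in> U \<Longrightarrow> \<exists>e>0. \<exists>L. L-lipschitz_on (ball x e) f"
  shows "negligible {x \<in> U. \<not> f differentiable (at x)}"
  unfolding locally_negligible_alt[of "{x \<in> U. \<not> f differentiable (at x)}"]
proof (intro ballI)
  let ?S = "{x \<in> U. \<not> f differentiable (at x)}"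
  fix x assume x: "x \<in> ?S"
  then obtain e L where e: "e > 0" and lip: "L-lipschitz_on (ball x e) f" using loc by blast
  have "negligible {y \<in> ball x e. \<not> (\<lambda>z. f z \<bullet> b) differentiable (at y)}" (is "negligible ?T")
    if b: "b \<in> Basis" for b
  proof -
    have "L-lipschitz_on (ball x e) (\<lambda>z. f z \<bullet> b)"
    proof (rule lipschitz_onI[OF _ lipschitz_on_nonneg[OF lip]])
      fix y z assume yz: "y \<in> ball x e" "z \<in> ball x e"
      have "dist (f y \<bullet> b) (f z \<bullet> b) \<le> dist (f y) (f z)"
        using Basis_le_norm[OF b, of "f y - f z"] by (simp add: dist_norm inner_diff_left)
      also have "\<dots> \<le> L * dist y z" by (rule lipschitz_onD[OF lip yz])
      finally show "dist (f y \<bullet> b) (f z \<bullet> b) \<le> L * dist y z" .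
    qed
    then obtain F where F: "L-lipschitz_on UNIV F" "\<And>y. y \<in> ball x e \<Longrightarrow> F y = f y \<bullet> b"
      using Lipschitz_extension_real by blast
    have "?T \<subseteq> {y. \<not> F differentiable (at y)}"
    proof clarsimp
      fix y assume y: "dist x y < e" "\<not> (\<lambda>z. f z \<bullet> b) differentiable (at y)" "F differentiable (at y)"
      obtain d where "d > 0" "ball y d \<subseteq> ball x e" using y(1) openE[of "ball x e" y] by auto
      have "(\<lambda>z. f z \<bullet> b) differentiable (at y)"
        by (rule differentiable_transform_within[OF y(3) \<open>d > 0\<close>])
          (use F(2) \<open>ball y d \<subseteq> ball x e\<close> in \<open>auto simp: dist_commute subset_iff\<close>)
      with y(2) show False by simp
    qed
    moreover have "negligible {y. \<not> F differentiable (at y)}"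
      using AE_completion[OF Rademacher_Lipschitz[OF F(1)]]
      by (simp add: negligible_iff_null_sets completion.AE_iff_null_sets)
    ultimately show ?thesis by (rule negligible_subset[rotated])
  qed
  then have "negligible (\<Union>b\<in>Basis. {y \<in> ball x e. \<not> (\<lambda>z. f z \<bullet> b) differentiable (at y)})"
    by (intro negligible_Union) auto
  moreover have "?S \<inter> ball x e \<subseteq> (\<Union>b\<in>Basis. {y \<in> ball x e. \<not> (\<lambda>z. f z \<bullet> b) differentiable (at y)})"
    using differentiable_componentwise_within[of f _ UNIV] by auto
  ultimately have "negligible (?S \<inter> ball x e)" by (rule negligible_subset)
  then show "\<exists>W. openin (top_of_set ?S) W \<and> x \<in> W \<and> negligible W"
    using x e by (intro exI[of _ "?S \<inter> ball x e"]) (auto simp: openin_open)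
qed

section \<open>Symmetry of second derivatives and the Hessian of the squared gradient norm\<close>

text \<open>The gradient \<open>g\<close> is differentiable at the single point \<open>x\<close>, as is the case when its derivative
  exists almost everywhere. The second difference of \<open>f\<close> with steps \<open>t a\<close> and \<open>t b\<close> is symmetric
  in \<open>a\<close> and \<open>b\<close>, and by the mean value theorem it equals \<open>t\<^sup>2 (G b \<bullet> a)\<close> up to \<open>o(t\<^sup>2)\<close>.\<close>

lemma symmetric_second_derivative:
  fixes f :: "'a::euclidean_space \<Rightarrow> real"
  assumes "d > 0" and grad: "\<And>y. y \<in> ball x d \<Longrightarrow> (f has_derivative (\<lambda>h. g y \<bullet> h)) (at y)"
    and g: "(g has_derivative G) (at x)"
  shows "G a \<bullet> b = G b \<bullet> a"
proof -
  have lin: "linear G" using g has_derivative_linear by blast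
  define S where "S = (\<lambda>a b t. f (x + t *\<^sub>R a + t *\<^sub>R b) - f (x + t *\<^sub>R a) - f (x + t *\<^sub>R b) + f x)"
  have lim: "((\<lambda>t. S a b t / t\<^sup>2) \<longlongrightarrow> G b \<bullet> a) (at_right 0)" for a b
  proof (rule tendstoI)
    fix \<epsilon> :: real assume \<epsilon>: "\<epsilon> > 0"
    define N where "N = 2 * norm a + norm b + 1"
    have N: "N > 0" by (simp add: N_def add_nonneg_pos)
    define \<eta> where "\<eta> = \<epsilon> / (2 * N * (norm a + 1))"
    have a1: "norm a + 1 > 0" by (simp add: add_nonneg_pos)
    have \<eta>: "\<eta> > 0" using \<epsilon> N a1 by (simp add: \<eta>_def)
    obtain \<delta> where \<delta>: "\<delta> > 0" "\<And>y. norm (y - x) < \<delta> \<Longrightarrow> norm (g y - g x - G (y - x)) \<le> \<eta> * norm (y - x)"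
      using g \<eta> unfolding has_derivative_at_alt by blast
    show "eventually (\<lambda>t. dist (S a b t / t\<^sup>2) (G b \<bullet> a) < \<epsilon>) (at_right 0)"
    proof (rule eventually_at_rightI)
      show "0 < min \<delta> d / N" using \<delta> \<open>d > 0\<close> N by simp
      fix t assume "t \<in> {0<..<min \<delta> d / N}"
      then have t: "t > 0" "t * N < \<delta>" "t * N < d" using N by (auto simp: field_simps min_def split: if_splits)
      have nrm: "norm ((s * t) *\<^sub>R a + r *\<^sub>R t *\<^sub>R b) \<le> t * (norm a + norm b)" 
        if "s \<in> {0..1}" "r \<in> {0, 1}" for s r
      proof -
        have "norm ((s * t) *\<^sub>R a + r *\<^sub>R t *\<^sub>R b) \<le> \<bar>s * t\<bar> * norm a + \<bar>r\<bar> * (\<bar>t\<bar> * norm b)"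
          by (rule norm_triangle_le) (simp add: abs_mult)
        also have "\<dots> \<le> t * norm a + t * norm b"
          using that t(1) by (intro add_mono mult_right_mono) (auto simp: abs_mult mult_left_le_one_le mult_right_le_one_le)
        finally show ?thesis by (simp add: distrib_left)
      qed
      have tN: "t * (norm a + norm b) < t * N" using t(1) by (simp add: N_def add_nonneg_pos)
      define \<phi> where "\<phi> = (\<lambda>s. f (x + ((s * t) *\<^sub>R a + 1 *\<^sub>R t *\<^sub>R b)) - f (x + ((s * t) *\<^sub>R a + 0 *\<^sub>R t *\<^sub>R b)))"
      let ?y = "\<lambda>s r. x + ((s * t) *\<^sub>R a + r *\<^sub>R t *\<^sub>R b)"
      have near: "?y s r \<in> ball x d" "norm (?y s r - x) < \<delta>" if "s \<in> {0..1}" "r \<in> {0, 1}" for s r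
      proof -
        have "norm (?y s r - x) < min \<delta> d" using nrm[OF that] tN t by (simp only: add_diff_cancel_left')
        then show "?y s r \<in> ball x d" "norm (?y s r - x) < \<delta>" by (simp_all only: mem_ball dist_norm norm_minus_commute[of x] min_less_iff_conj)
      qed
      have der: "((\<lambda>s. f (?y s r)) has_real_derivative (g (?y s r) \<bullet> (t *\<^sub>R a))) (at s)"
        if "s \<in> {0..1}" "r \<in> {0, 1}" for s r
      proof -
        have "((\<lambda>s. ?y s r) has_derivative (\<lambda>h. (h * t) *\<^sub>R a)) (at s)"
          by (auto intro!: derivative_eq_intros)
        from has_derivative_compose[OF this grad[OF near(1)[OF that]]]
        show ?thesis by (simp add: has_field_derivative_def mult_commute_abs mult_ac)
      qed
      have mv: "\<exists>\<sigma>. 0 < \<sigma> \<and> \<sigma> < 1 \<and> \<phi> 1 - \<phi> 0 = (1 - 0) * (g (?y \<sigma> 1) \<bullet> (t *\<^sub>R a) - g (?y \<sigma> 0) \<bullet> (t *\<^sub>R a))"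
        unfolding \<phi>_def by (rule MVT2) (simp, rule DERIV_diff, (rule der; simp)+)
      obtain \<sigma> where \<sigma>: "\<sigma> \<in> {0..1}" "S a b t = (g (?y \<sigma> 1) - g (?y \<sigma> 0)) \<bullet> (t *\<^sub>R a)"
      proof -
        have S\<phi>: "S a b t = \<phi> 1 - \<phi> 0" by (simp add: S_def \<phi>_def algebra_simps)
        from mv obtain s where "0 < s" "s < 1" "\<phi> 1 - \<phi> 0 = (g (?y s 1) - g (?y s 0)) \<bullet> (t *\<^sub>R a)"
          by (auto simp only: inner_diff_left diff_zero mult_1)
        with S\<phi> that[of s] show ?thesis by simp
      qed
      define R where "R = (\<lambda>r. g (?y \<sigma> r) - g x - G (?y \<sigma> r - x))"
      have Rb: "norm (R r) \<le> \<eta> * (t * N)" if "r \<in> {0, 1}" for r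
      proof -
        have "norm (R r) \<le> \<eta> * norm (?y \<sigma> r - x)"
          unfolding R_def by (rule \<delta>(2)[OF near(2)[OF \<sigma>(1) that]])
        also have "\<dots> \<le> \<eta> * (t * N)"
          using nrm[OF \<sigma>(1) that] tN \<eta> by (intro mult_left_mono) auto
        finally show ?thesis .
      qed
      have gd: "g (?y \<sigma> 1) - g (?y \<sigma> 0) = t *\<^sub>R G b + (R 1 - R 0)"
        unfolding R_def by (simp add: linear_add[OF lin] linear_scale[OF lin])
      have "S a b t = t\<^sup>2 * (G b \<bullet> a) + t * ((R 1 - R 0) \<bullet> a)"
        unfolding \<sigma>(2) gd by (simp add: inner_add_left power2_eq_square algebra_simps)
      then have "S a b t / t\<^sup>2 - G b \<bullet> a = ((R 1 - R 0) \<bullet> a) / t"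
        using t(1) by (simp add: field_simps power2_eq_square)
      moreover have "\<bar>(R 1 - R 0) \<bullet> a\<bar> \<le> (2 * (\<eta> * (t * N))) * norm a"
      proof -
        have "\<bar>(R 1 - R 0) \<bullet> a\<bar> \<le> norm (R 1 - R 0) * norm a" by (rule Cauchy_Schwarz_ineq2)
        also have "norm (R 1 - R 0) \<le> 2 * (\<eta> * (t * N))"
          using norm_triangle_ineq4[of "R 1" "R 0"] Rb[of 1] Rb[of 0] by simp
        finally show ?thesis by (simp add: mult_right_mono)
      qed
      ultimately have "\<bar>S a b t / t\<^sup>2 - G b \<bullet> a\<bar> \<le> 2 * \<eta> * N * norm a"
        using t(1) by (simp add: divide_le_eq mult_ac)
      also have "\<dots> < 2 * \<eta> * N * (norm a + 1)"
        using \<eta> N by simp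
      also have "\<dots> = \<epsilon>"
      proof -
        have "2 * (\<epsilon> / (2 * N * k)) * N * k = \<epsilon>" if "k > 0" for k using that N by simp
        with a1 show ?thesis unfolding \<eta>_def by blast
      qed
      finally show "dist (S a b t / t\<^sup>2) (G b \<bullet> a) < \<epsilon>" by (simp add: dist_real_def)
    qed
  qed
  have "S a b = S b a" by (auto simp: S_def algebra_simps)
  with lim[of a b] lim[of b a] show ?thesis
    using tendsto_unique[OF trivial_limit_at_right_real] by (metis)
qed

lemma bounded_bilinear_matrix_vector_mult:
  "bounded_bilinear ((*v) :: real^'n^'m \<Rightarrow> real^'n \<Rightarrow> real^'m)"
proof -
  have "bilinear ((*v) :: real^'n^'m \<Rightarrow> real^'n \<Rightarrow> real^'m)"
    unfolding bilinear_def
    by (auto intro!: linearI simp: matrix_vector_mult_def vec_eq_iff sum.distrib algebra_simps sum_distrib_left)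
  then show ?thesis by (simp add: bilinear_conv_bounded_bilinear)
qed

lemma inner_matrix_vector_symmetric:
  fixes A :: "real^'n^'n"
  assumes "transpose A = A"
  shows "x \<bullet> (A *v y) = (A *v x) \<bullet> y"
proof -
  have "A *v x = x v* A" using assms transpose_matrix_vector[of A x] by simp
  then show ?thesis by (simp add: dot_lmul_matrix)
qed

lemma jacobian_eqI:
  fixes f :: "real^'n \<Rightarrow> real^'m"
  assumes "(f has_derivative (\<lambda>h. M *v h)) (at x)"
  shows "jacobian f (at x) = M"
  unfolding jacobian_def frechet_derivative_at[OF assms, symmetric] by (rule matrix_of_matrix_vector_mul)

lemma grad_eqI:
  fixes f :: "real^'n \<Rightarrow> real"
  assumes "(f has_derivative (\<lambda>h. g \<bullet> h)) (at x)"
  shows "grad f x = g"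
  unfolding grad_def frechet_derivative_at[OF assms, symmetric]
  by (simp add: vec_eq_iff inner_axis)

lemma jacobian_of_gradient_symmetric:
  fixes v :: "real^'n \<Rightarrow> real^'n"
  assumes U: "open U" "x \<in> U" and pot: "\<And>y. y \<in> U \<Longrightarrow> (\<mu> has_derivative (\<lambda>h. v y \<bullet> h)) (at y)"
    and dv: "v differentiable (at x)"
  shows "transpose (jacobian v (at x)) = jacobian v (at x)"
proof -
  obtain d where d: "d > 0" "ball x d \<subseteq> U" using U openE by blast
  have "(jacobian v (at x) *v a) \<bullet> b = (jacobian v (at x) *v b) \<bullet> a" for a b
    by (rule symmetric_second_derivative[where f = \<mu> and g = v, OF d(1)])
      (use d pot dv in \<open>auto simp: jacobian_works[symmetric]\<close>)
  from this[of "axis i 1" "axis j 1" for i j] show ?thesis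
    by (simp add: vec_eq_iff transpose_def matrix_vector_mult_basis column_def inner_axis)
qed

text \<open>Near \<open>x\<close> the gradient of \<open>|\<nabla>\<mu>|\<^sup>2\<close> is \<open>2 G v\<close> with \<open>G = Dv\<close>. Its derivative in direction \<open>h\<close> contains
  \<open>(D h) v\<close>. Each row of \<open>G\<close> is the gradient of a component of \<open>v\<close>, so the symmetry of second
  derivatives, applied to these components, turns this term into \<open>(D v) h\<close>, the variation of the
  Hessian along the flow.\<close>

lemma hessian_norm_gradient_squared:
  fixes v :: "real^'n \<Rightarrow> real^'n"
  assumes U: "open U" "x \<in> U" and pot: "\<And>y. y \<in> U \<Longrightarrow> (\<mu> has_derivative (\<lambda>h. v y \<bullet> h)) (at y)"
    and dv: "\<And>y. y \<in> U \<Longrightarrow> v differentiable (at y)"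
    and D: "((\<lambda>y. jacobian v (at y)) has_derivative D) (at x)"
  shows "hessian (\<lambda>y. (norm (grad \<mu> y))\<^sup>2) x =
      2 *\<^sub>R (D (v x) + jacobian v (at x) ** jacobian v (at x))"
proof -
  define G where "G = (\<lambda>y. jacobian v (at y))"
  have vG: "(v has_derivative (\<lambda>h. G y *v h)) (at y)" if "y \<in> U" for y
    using dv[OF that] by (simp add: jacobian_works G_def)
  have sym: "transpose (G y) = G y" if "y \<in> U" for y
    unfolding G_def using jacobian_of_gradient_symmetric[OF U(1) that pot dv[OF that]] .
  have gradU: "grad \<mu> y = v y" if "y \<in> U" for y by (rule grad_eqI[OF pot[OF that]])
  have grad2: "grad (\<lambda>y. (norm (grad \<mu> y))\<^sup>2) y = 2 *\<^sub>R (G y *v v y)" if y: "y \<in> U" for y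
  proof (rule grad_eqI)
    have "((\<lambda>y. v y \<bullet> v y) has_derivative (\<lambda>h. v y \<bullet> (G y *v h) + (G y *v h) \<bullet> v y)) (at y)"
      by (intro has_derivative_inner vG y)
    moreover have "v y \<bullet> (G y *v h) + (G y *v h) \<bullet> v y = (2 *\<^sub>R (G y *v v y)) \<bullet> h" for h
      using inner_matrix_vector_symmetric[OF sym[OF y], of "v y" h] by (simp add: inner_commute)
    ultimately have "((\<lambda>y. v y \<bullet> v y) has_derivative (\<lambda>h. (2 *\<^sub>R (G y *v v y)) \<bullet> h)) (at y)" by simp
    then show "((\<lambda>y. (norm (grad \<mu> y))\<^sup>2) has_derivative (\<lambda>h. (2 *\<^sub>R (G y *v v y)) \<bullet> h)) (at y)"
      by (rule has_derivative_transform_within_open[OF _ U(1) y]) (simp add: gradU power2_norm_eq_inner)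
  qed
  obtain d where d: "d > 0" "ball x d \<subseteq> U" using U openE by blast
  \<comment> \<open>Third derivatives of \<open>\<mu>\<close> commute.\<close>
  have D3: "D h *v v x = D (v x) *v h" for h
  proof -
    have "(D a $ i) \<bullet> b = (D b $ i) \<bullet> a" for a b i
    proof (rule symmetric_second_derivative[where f = "\<lambda>y. v y $ i" and g = "\<lambda>y. G y $ i", OF d(1)])
      show "((\<lambda>y. v y $ i) has_derivative (\<lambda>h. G y $ i \<bullet> h)) (at y)" if "y \<in> ball x d" for y
      proof -
        have "y \<in> U" using that d by auto
        from bounded_linear.has_derivative[OF bounded_linear_vec_nth[of i] vG[OF this]]
        show ?thesis by (simp add: matrix_vector_mul_component)
      qed
      show "((\<lambda>y. G y $ i) has_derivative (\<lambda>a. D a $ i)) (at x)"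
        using bounded_linear.has_derivative[OF bounded_linear_vec_nth[of i] D] by (simp add: G_def)
    qed
    then show ?thesis by (simp add: vec_eq_iff matrix_vector_mul_component)
  qed
  have "((\<lambda>y. 2 *\<^sub>R (G y *v v y)) has_derivative (\<lambda>h. 2 *\<^sub>R (G x *v (G x *v h) + D h *v v x))) (at x)"
    by (intro has_derivative_scaleR_right bounded_bilinear.FDERIV[OF bounded_bilinear_matrix_vector_mult] vG U)
      (use D in \<open>simp add: G_def\<close>)
  moreover have "2 *\<^sub>R (G x *v (G x *v h) + D h *v v x) = (2 *\<^sub>R (D (v x) + G x ** G x)) *v h" for h
    by (simp add: D3 scaleR_matrix_vector_assoc[symmetric] matrix_vector_mult_add_rdistrib matrix_vector_mul_assoc add.commute)
  ultimately have "((\<lambda>y. 2 *\<^sub>R (G y *v v y)) has_derivative (\<lambda>h. (2 *\<^sub>R (D (v x) + G x ** G x)) *v h)) (at x)"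
    by simp
  then have "(grad (\<lambda>y. (norm (grad \<mu> y))\<^sup>2) has_derivative (\<lambda>h. (2 *\<^sub>R (D (v x) + G x ** G x)) *v h)) (at x)"
    by (rule has_derivative_transform_within_open[OF _ U]) (simp add: grad2)
  from jacobian_eqI[OF this] show ?thesis by (simp add: hessian_def G_def)
qed

section \<open>Differentiability of a flow in its initial point\<close>

lemma vector_mean_value_bound:
  fixes c :: "real \<Rightarrow> 'a::euclidean_space"
  assumes "\<And>t. t \<in> {a..b} \<Longrightarrow> (c has_vector_derivative c' t) (at t)"
    and "\<And>t. t \<in> {a<..<b} \<Longrightarrow> norm (c' t) \<le> M" and "a \<le> b"
  shows "norm (c b - c a) \<le> M * (b - a)"
proof (cases "a = b")
  case False
  then have ab: "a < b" using assms(3) by simp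
  have "continuous_on {a..b} c"
    using assms(1) by (meson continuous_at_imp_continuous_on has_vector_derivative_continuous)
  from mvt_general[OF ab this, of "\<lambda>t s. s *\<^sub>R c' t"] assms(1)
  obtain t where t: "t \<in> {a<..<b}" "norm (c b - c a) \<le> norm ((b - a) *\<^sub>R c' t)"
    by (auto simp: has_vector_derivative_def)
  note t(2)
  also have "norm ((b - a) *\<^sub>R c' t) \<le> (b - a) * M"
    using assms(2)[OF t(1)] ab by (simp add: mult_left_mono)
  finally show ?thesis by (simp add: mult.commute)
qed simp

lemma has_vector_derivative_reflect:
  fixes c :: "real \<Rightarrow> 'a::real_normed_vector"
  assumes "(c has_vector_derivative d) (at (- t))"
  shows "((\<lambda>s. c (- s)) has_vector_derivative - d) (at t)"
proof -
  have "((\<lambda>s. - s) has_vector_derivative - 1) (at t)"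
    by (auto intro!: derivative_eq_intros)
  from vector_diff_chain_at[OF this assms] show ?thesis by (simp add: o_def)
qed

text \<open>At the first time the distance \<open>\<rho>\<close> is reached the speed has been bounded by \<open>M\<close> so far, hence the
  distance is at most \<open>M \<tau> < \<rho>\<close>.\<close>

lemma curve_stays_near_forward:
  fixes c :: "real \<Rightarrow> 'a::euclidean_space"
  assumes der: "\<And>t. 0 \<le> t \<Longrightarrow> t \<le> \<tau> \<Longrightarrow> (c has_vector_derivative c' t) (at t)"
    and bd: "\<And>t. 0 \<le> t \<Longrightarrow> t \<le> \<tau> \<Longrightarrow> norm (c t - c 0) < \<rho> \<Longrightarrow> norm (c' t) \<le> M"
    and M: "M * \<tau> < \<rho>" "M \<ge> 0" and t: "0 \<le> t" "t \<le> \<tau>"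
  shows "norm (c t - c 0) < \<rho>"
proof (rule ccontr)
  assume neg: "\<not> ?thesis"
  have cont: "continuous_on {0..t} c"
    using der t by (intro continuous_at_imp_continuous_on ballI)
      (meson atLeastAtMost_iff has_vector_derivative_continuous order_trans)
  define S where "S = {s \<in> {0..t}. \<rho> \<le> norm (c s - c 0)}"
  have "closed S"
    unfolding S_def by (intro continuous_on_closed_Collect_le continuous_intros cont)
  moreover have "bounded S" unfolding S_def by (rule bounded_subset[of "{0..t}"]) auto
  ultimately have "compact S" by (simp add: compact_eq_bounded_closed)
  moreover have "S \<noteq> {}" using neg t by (auto simp: S_def)
  ultimately obtain s where s: "s \<in> S" "\<And>r. r \<in> S \<Longrightarrow> s \<le> r"
    using compact_attains_inf by metis
  have "norm (c s - c 0) \<le> M * (s - 0)"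
  proof (rule vector_mean_value_bound)
    show "(c has_vector_derivative c' r) (at r)" if "r \<in> {0..s}" for r
      using that s(1) t der by (auto simp: S_def)
    fix r assume r: "r \<in> {0<..<s}"
    then have "r \<notin> S" using s(2)[of r] by auto
    then have "norm (c r - c 0) < \<rho>" using r s(1) by (auto simp: S_def)
    then show "norm (c' r) \<le> M" using r s(1) t by (intro bd) (auto simp: S_def)
  qed (use s(1) in \<open>auto simp: S_def\<close>)
  also have "\<dots> \<le> M * \<tau>" using s(1) M(2) t by (intro mult_left_mono) (auto simp: S_def)
  finally show False using M(1) s(1) by (auto simp: S_def)
qed

lemma curve_stays_near:
  fixes c :: "real \<Rightarrow> 'a::euclidean_space"
  assumes der: "\<And>t. \<bar>t\<bar> \<le> \<tau> \<Longrightarrow> (c has_vector_derivative c' t) (at t)"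
    and bd: "\<And>t. \<bar>t\<bar> \<le> \<tau> \<Longrightarrow> norm (c t - c 0) < \<rho> \<Longrightarrow> norm (c' t) \<le> M"
    and M: "M * \<tau> < \<rho>" "M \<ge> 0" and t: "\<bar>t\<bar> \<le> \<tau>"
  shows "norm (c t - c 0) < \<rho>"
proof (cases "t \<ge> 0")
  case True
  show ?thesis
    by (rule curve_stays_near_forward[OF der bd M True]) (use t in auto)
next
  case False
  have "norm (c (- (- t)) - c (- 0)) < \<rho>"
    by (rule curve_stays_near_forward[where c' = "\<lambda>s. - c' (- s)" and \<tau> = \<tau>])
       (use t False M bd in \<open>auto intro!: has_vector_derivative_reflect der\<close>)
  then show ?thesis by simp
qed

text \<open>As \<open>B \<tau> \<le> 1/2\<close>, the estimate closes without an exponential: at the time where \<open>norm (w t)\<close> is largest, the mean value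
  inequality bounds this maximum by \<open>norm (w 0) + \<tau> \<rho>\<close> plus at most half of itself.\<close>

lemma small_time_Gronwall:
  fixes w :: "real \<Rightarrow> 'a::euclidean_space"
  assumes der: "\<And>t. \<bar>t\<bar> \<le> \<tau> \<Longrightarrow> (w has_vector_derivative w' t) (at t)"
    and bd: "\<And>t. \<bar>t\<bar> \<le> \<tau> \<Longrightarrow> norm (w' t) \<le> B * norm (w t) + \<rho>"
    and B: "B \<ge> 0" "B * \<tau> \<le> 1/2" and \<rho>: "\<rho> \<ge> 0" and t: "\<bar>t\<bar> \<le> \<tau>"
  shows "norm (w t) \<le> 2 * (norm (w 0) + \<tau> * \<rho>)"
proof -
  have cont: "continuous_on {-\<tau>..\<tau>} w"
    using der by (intro continuous_at_imp_continuous_on ballI)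
      (meson abs_leI atLeastAtMost_iff has_vector_derivative_continuous minus_le_iff)
  have "\<exists>s\<in>{-\<tau>..\<tau>}. \<forall>r\<in>{-\<tau>..\<tau>}. norm (w r) \<le> norm (w s)"
    using t by (intro continuous_attains_sup continuous_intros cont) auto
  then obtain s where s: "\<bar>s\<bar> \<le> \<tau>" and smax: "\<And>r. \<bar>r\<bar> \<le> \<tau> \<Longrightarrow> norm (w r) \<le> norm (w s)"
    using abs_le_iff minus_le_iff atLeastAtMost_iff by metis
  define m where "m = B * norm (w s) + \<rho>"
  have m0: "m \<ge> 0" using B \<rho> by (simp add: m_def)
  have w'm: "norm (w' r) \<le> m" if "\<bar>r\<bar> \<le> \<tau>" for r
    using bd[OF that] mult_left_mono[OF smax[OF that] B(1)] by (simp add: m_def)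
  have "norm (w s - w 0) \<le> m * \<bar>s\<bar>"
  proof (cases "s \<ge> 0")
    case True
    have "norm (w s - w 0) \<le> m * (s - 0)"
      using True s by (intro vector_mean_value_bound[where c' = w'] der w'm) auto
    then show ?thesis using True by simp
  next
    case False
    have "norm (w 0 - w s) \<le> m * (0 - s)"
      using False s by (intro vector_mean_value_bound[where c' = w'] der w'm) auto
    then show ?thesis using False by (simp add: norm_minus_commute)
  qed
  also have "\<dots> \<le> m * \<tau>" using s m0 by (rule mult_left_mono)
  also have "\<dots> = (B * \<tau>) * norm (w s) + \<tau> * \<rho>" by (simp add: m_def algebra_simps)
  also have "\<dots> \<le> 1/2 * norm (w s) + \<tau> * \<rho>"
    using mult_right_mono[OF B(2), of "norm (w s)"] by simp
  finally have "norm (w s) \<le> 2 * (norm (w 0) + \<tau> * \<rho>)"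
    using norm_triangle_sub[of "w s" "w 0"] by simp
  with smax[OF t] show ?thesis by simp
qed

text \<open>Write \<open>G y\<close> for the derivative of \<open>v\<close> at \<open>y\<close>. For a direction \<open>h\<close> the difference quotients \<open>d n\<close> of
  the flow solve \<open>d' = G (T t x) d\<close> up to an error of the size of the step, since \<open>G\<close> is Lipschitz. By
  the Gronwall estimate they are uniformly Cauchy, and their limit \<open>D h\<close> solves the linear equation
  exactly; solutions are unique, so \<open>D h\<close> is linear in \<open>h\<close>. The same estimate applied to
  \<open>T t y - T t x - D (y - x) t\<close> bounds it by a multiple of \<open>(norm (y - x))\<^sup>2\<close>. All this happens on a
  time interval so short that trajectories starting near \<open>x\<close> stay in the ball where \<open>v\<close> is
  controlled.\<close>

lemma flow_differentiable:
  fixes v :: "'a::euclidean_space \<Rightarrow> 'a" and T :: "real \<Rightarrow> 'a \<Rightarrow> 'a" and G :: "'a \<Rightarrow> 'a \<Rightarrow> 'a"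
  assumes r: "r > 0" and \<delta>: "\<delta> > 0" and L: "L \<ge> 0" and B: "B \<ge> 0"
    and vG: "\<And>y. y \<in> ball x r \<Longrightarrow> (v has_derivative G y) (at y)"
    and GB: "\<And>y h. y \<in> ball x r \<Longrightarrow> norm (G y h) \<le> B * norm h"
    and GL: "\<And>y z h. y \<in> ball x r \<Longrightarrow> z \<in> ball x r \<Longrightarrow> norm (G y h - G z h) \<le> L * norm (y - z) * norm h"
    and T0: "\<And>y. y \<in> ball x r \<Longrightarrow> T 0 y = y"
    and T': "\<And>y t. y \<in> ball x r \<Longrightarrow> \<bar>t\<bar> < \<delta> \<Longrightarrow> ((\<lambda>s. T s y) has_vector_derivative v (T t y)) (at t)"
  obtains \<tau> J where "\<tau> > 0" "\<And>h. J 0 h = h"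
    "\<And>t. \<bar>t\<bar> < \<tau> \<Longrightarrow> T t x \<in> ball x r"
    "\<And>t. \<bar>t\<bar> < \<tau> \<Longrightarrow> (T t has_derivative J t) (at x)"
    "\<And>t h. \<bar>t\<bar> < \<tau> \<Longrightarrow> ((\<lambda>s. J s h) has_vector_derivative G (T t x) (J t h)) (at t)"
proof -
  \<comment> \<open>A bound for the speed on \<open>ball x r\<close>; \<open>\<tau>\<close> keeps trajectories from \<open>ball x (r/2)\<close> in that ball and makes \<open>B \<tau> \<le> 1/2\<close>.\<close>
  define M where "M = norm (v x) + B * r"
  have M: "M \<ge> 0" using B r by (simp add: M_def)
  define \<tau> where "\<tau> = min (\<delta> / 2) (min (1 / (2 * (B + 1))) (r / (4 * (M + 1))))"
  have \<tau>0: "\<tau> > 0" using \<delta> B M r by (simp add: \<tau>_def)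
  have \<tau>\<delta>: "\<tau> < \<delta>" using \<delta> by (simp add: \<tau>_def)
  have \<tau>B: "B * \<tau> \<le> 1/2"
  proof -
    have "B * \<tau> \<le> (B + 1) * (1 / (2 * (B + 1)))" using B \<tau>0 by (intro mult_mono) (auto simp: \<tau>_def)
    also have "\<dots> = 1/2" using B by simp
    finally show ?thesis .
  qed
  have \<tau>M: "M * \<tau> < r / 2"
  proof -
    have "M * \<tau> \<le> (M + 1) * (r / (4 * (M + 1)))" using M \<tau>0 by (intro mult_mono) (auto simp: \<tau>_def)
    also have "\<dots> = r / 4"
    proof -
      have "k * (r / (4 * k)) = r / 4" if "k > 0" for k :: real using that by simp
      then show ?thesis using M by (simp only: add_nonneg_pos zero_less_one)
    qed
    finally show ?thesis using r by simp
  qed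
  have linG: "linear (G y)" if "y \<in> ball x r" for y
    using vG[OF that] has_derivative_linear by blast
  have vLip: "norm (v y - v z) \<le> B * norm (y - z)" if "y \<in> ball x r" "z \<in> ball x r" for y z
  proof (rule differentiable_bound[of "ball x r" v G])
    show "(v has_derivative G p) (at p within ball x r)" if "p \<in> ball x r" for p
      using vG[OF that] by (rule has_derivative_at_withinI)
    show "onorm (G p) \<le> B" if "p \<in> ball x r" for p
      using GB[OF that] by (rule onorm_le)
  qed (use that in auto)
  have vM: "norm (v y) \<le> M" if "y \<in> ball x r" for y
  proof -
    have "norm (v y) \<le> norm (v x) + norm (v y - v x)" by (rule norm_triangle_sub)
    also have "norm (v y - v x) \<le> B * norm (y - x)" using that r by (intro vLip) auto
    also have "\<dots> \<le> B * r" using that B by (intro mult_left_mono) (auto simp: dist_norm norm_minus_commute)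
    finally show ?thesis by (simp add: M_def)
  qed
  have taylor: "norm (v z - v y - G y (z - y)) \<le> L * (norm (z - y))\<^sup>2"
    if y: "y \<in> ball x r" and z: "z \<in> ball x r" for y z
  proof -
    have seg: "y + s *\<^sub>R (z - y) \<in> closed_segment y z" if "s \<in> {0..1}" for s
      using that unfolding in_segment by (intro exI[of _ s]) (auto simp: algebra_simps)
    have sub: "closed_segment y z \<subseteq> ball x r"
      using y z by (intro closed_segment_subset) auto
    have "norm (v z - v y - G y (z - y)) \<le> norm (z - y) * (L * norm (z - y))"
    proof (rule differentiable_bound_linearization[where f = v and f' = G and ?x0.0 = y, OF seg])
      show "(v has_derivative G p) (at p within closed_segment y z)" if "p \<in> closed_segment y z" for p
        by (rule has_derivative_at_withinI[OF vG[OF subsetD[OF sub that]]])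
      show "onorm (G p - G y) \<le> L * norm (z - y)" if p: "p \<in> closed_segment y z" for p
      proof (rule onorm_le)
        fix h
        have "norm ((G p - G y) h) \<le> L * norm (p - y) * norm h"
          using GL[of p y h] p sub y by auto
        also have "\<dots> \<le> L * norm (z - y) * norm h"
          using segment_bound(1)[OF p] L by (intro mult_left_mono mult_right_mono) auto
        finally show "norm ((G p - G y) h) \<le> L * norm (z - y) * norm h" .
      qed
    qed auto
    then show ?thesis by (simp add: power2_eq_square mult_ac)
  qed
  have stay: "T t y \<in> ball x r" if y: "y \<in> ball x (r/2)" and t: "\<bar>t\<bar> \<le> \<tau>" for y t
  proof -
    have y': "y \<in> ball x r" using y r by auto
    have in_ball: "T s y \<in> ball x r" if "norm (T s y - T 0 y) < r/2" for s
      using that y T0[OF y'] dist_triangle[of x "T s y" y] by (auto simp: dist_norm norm_minus_commute)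
    have "norm (T t y - T 0 y) < r/2"
    proof (rule curve_stays_near[where c = "\<lambda>t. T t y" and c' = "\<lambda>t. v (T t y)" and \<tau> = \<tau>])
      show "((\<lambda>t. T t y) has_vector_derivative v (T s y)) (at s)" if "\<bar>s\<bar> \<le> \<tau>" for s
        using T'[OF y'] that \<tau>\<delta> by auto
    qed (use in_ball vM \<tau>M M t in auto)
    then show ?thesis by (rule in_ball)
  qed
  have x0: "x \<in> ball x (r/2)" "x \<in> ball x r" using r by auto
  have Tx: "T t x \<in> ball x r" if "\<bar>t\<bar> \<le> \<tau>" for t using stay[OF x0(1) that] .
  have derT: "((\<lambda>s. T s y) has_vector_derivative v (T t y)) (at t)"
    if "y \<in> ball x (r/2)" "\<bar>t\<bar> \<le> \<tau>" for y t
    using T'[of y t] that \<tau>\<delta> r by auto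
  have close: "norm (T t y - T t x) \<le> 2 * norm (y - x)"
    if y: "y \<in> ball x (r/2)" and t: "\<bar>t\<bar> \<le> \<tau>" for y t
  proof -
    have "norm (T t y - T t x) \<le> 2 * (norm (T 0 y - T 0 x) + \<tau> * 0)"
    proof (rule small_time_Gronwall[where w = "\<lambda>t. T t y - T t x" and w' = "\<lambda>t. v (T t y) - v (T t x)"])
      show "((\<lambda>t. T t y - T t x) has_vector_derivative v (T s y) - v (T s x)) (at s)" if "\<bar>s\<bar> \<le> \<tau>" for s
        by (intro has_vector_derivative_diff derT y x0 that)
      show "norm (v (T s y) - v (T s x)) \<le> B * norm (T s y - T s x) + 0" if "\<bar>s\<bar> \<le> \<tau>" for s
        using vLip[OF stay[OF y that] Tx[OF that]] by simp
    qed (use B \<tau>B t in auto)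
    then show ?thesis using T0[of y] T0[of x] y r by simp
  qed
  have rem: "norm (v (T t y) - v (T t x) - G (T t x) (T t y - T t x)) \<le> 4 * L * (norm (y - x))\<^sup>2"
    if y: "y \<in> ball x (r/2)" and t: "\<bar>t\<bar> \<le> \<tau>" for y t
  proof -
    have "norm (v (T t y) - v (T t x) - G (T t x) (T t y - T t x)) \<le> L * (norm (T t y - T t x))\<^sup>2"
      by (rule taylor[OF Tx[OF t] stay[OF y t]])
    also have "\<dots> \<le> L * (2 * norm (y - x))\<^sup>2"
      using close[OF y t] L by (intro mult_left_mono power_mono) auto
    finally show ?thesis by (simp add: power_mult_distrib mult_ac)
  qed

  have "\<exists>d. d 0 = h \<and> (\<forall>t. \<bar>t\<bar> < \<tau> \<longrightarrow> (d has_vector_derivative G (T t x) (d t)) (at t))" for h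
  proof -
    define k where "k = norm h + 1"
    have k: "k > 0" "norm h < k" by (auto simp: k_def add_nonneg_pos)
    \<comment> \<open>Steps small enough that \<open>x + \<epsilon> n h\<close> stays in \<open>ball x (r/2)\<close>.\<close>
    define \<epsilon> where "\<epsilon> = (\<lambda>n. r / (2 * k) * inverse (real (Suc n)))"
    have \<epsilon>0: "\<epsilon> n > 0" for n using r k by (simp add: \<epsilon>_def)
    have \<epsilon>le: "\<epsilon> n \<le> r / (2 * k)" for n
      unfolding \<epsilon>_def using r k by (intro mult_left_le) (auto simp: field_simps)
    have "\<epsilon> \<longlonglongrightarrow> r / (2 * k) * 0"
      unfolding \<epsilon>_def by (intro tendsto_intros LIMSEQ_inverse_real_of_nat)
    then have \<epsilon>lim: "\<epsilon> \<longlonglongrightarrow> 0" by simp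
    define y where "y = (\<lambda>n. x + \<epsilon> n *\<^sub>R h)"
    have y: "y n \<in> ball x (r/2)" for n
    proof -
      have "\<epsilon> n * norm h < \<epsilon> n * k" using \<epsilon>0 k by simp
      also have "\<dots> \<le> r / (2 * k) * k" using \<epsilon>le k by (intro mult_right_mono) auto
      finally show ?thesis using \<epsilon>0[of n] k by (simp add: y_def dist_norm)
    qed
    have y': "y n \<in> ball x r" for n using y[of n] r by simp
    define d where "d = (\<lambda>n t. (T t (y n) - T t x) /\<^sub>R \<epsilon> n)"
    define d' where "d' = (\<lambda>n t. (v (T t (y n)) - v (T t x)) /\<^sub>R \<epsilon> n)"
    define C where "C = 4 * L * (norm h)\<^sup>2"
    have C: "C \<ge> 0" using L by (simp add: C_def)
    have d0: "d n 0 = h" for n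
      using \<epsilon>0[of n] T0[OF y'[of n]] T0[OF x0(2)] by (simp add: d_def y_def)
    have dd: "(d n has_vector_derivative d' n t) (at t)" if "\<bar>t\<bar> \<le> \<tau>" for n t
      unfolding d_def d'_def
      using bounded_linear.has_vector_derivative[OF bounded_linear_scaleR_right
          has_vector_derivative_diff[OF derT[OF y that] derT[OF x0(1) that]], of "inverse (\<epsilon> n)"]
      by simp
    have d'G: "norm (d' n t - G (T t x) (d n t)) \<le> C * \<epsilon> n" if "\<bar>t\<bar> \<le> \<tau>" for n t
    proof -
      have "d' n t - G (T t x) (d n t) =
          (v (T t (y n)) - v (T t x) - G (T t x) (T t (y n) - T t x)) /\<^sub>R \<epsilon> n"
        unfolding d_def d'_def linear_scale[OF linG[OF Tx[OF that]]] by (simp add: scaleR_diff_right)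
      then have "norm (d' n t - G (T t x) (d n t)) =
          norm (v (T t (y n)) - v (T t x) - G (T t x) (T t (y n) - T t x)) / \<epsilon> n"
        using \<epsilon>0[of n] by (simp add: divide_inverse mult.commute)
      also have "\<dots> \<le> 4 * L * (norm (y n - x))\<^sup>2 / \<epsilon> n"
        using rem[OF y that] \<epsilon>0[of n] by (intro divide_right_mono) auto
      also have "\<dots> = C * \<epsilon> n"
        using \<epsilon>0[of n] by (simp add: C_def y_def power2_eq_square)
      finally show ?thesis .
    qed
    have cauchy: "norm (d n t - d m t) \<le> 2 * (\<tau> * (C * \<epsilon> n + C * \<epsilon> m))" if t: "\<bar>t\<bar> \<le> \<tau>" for n m t
    proof -
      have "norm (d n t - d m t) \<le> 2 * (norm (d n 0 - d m 0) + \<tau> * (C * \<epsilon> n + C * \<epsilon> m))"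
      proof (rule small_time_Gronwall[where w = "\<lambda>t. d n t - d m t" and w' = "\<lambda>t. d' n t - d' m t"])
        show "((\<lambda>t. d n t - d m t) has_vector_derivative d' n s - d' m s) (at s)" if "\<bar>s\<bar> \<le> \<tau>" for s
          by (intro has_vector_derivative_diff dd that)
        show "norm (d' n s - d' m s) \<le> B * norm (d n s - d m s) + (C * \<epsilon> n + C * \<epsilon> m)" if "\<bar>s\<bar> \<le> \<tau>" for s
        proof -
          have eq: "d' n s - d' m s = G (T s x) (d n s - d m s) +
             ((d' n s - G (T s x) (d n s)) - (d' m s - G (T s x) (d m s)))"
            by (simp add: linear_diff[OF linG[OF Tx[OF that]]])
          have "norm (d' n s - d' m s) \<le> norm (G (T s x) (d n s - d m s)) +
             (norm (d' n s - G (T s x) (d n s)) + norm (d' m s - G (T s x) (d m s)))"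
            unfolding eq by (intro norm_triangle_le add_left_mono norm_triangle_ineq4)
          also have "\<dots> \<le> B * norm (d n s - d m s) + (C * \<epsilon> n + C * \<epsilon> m)"
            by (intro add_mono GB Tx d'G that)
          finally show ?thesis .
        qed
        show "0 \<le> C * \<epsilon> n + C * \<epsilon> m"
          by (intro add_nonneg_nonneg mult_nonneg_nonneg C less_imp_le[OF \<epsilon>0])
      qed (use B \<tau>B t in auto)
      then show ?thesis using d0 by simp
    qed
    have "\<exists>l. (\<lambda>n. d n t) \<longlonglongrightarrow> l" if t: "\<bar>t\<bar> \<le> \<tau>" for t
    proof -
      have "Cauchy (\<lambda>n. d n t)"
      proof (rule metric_CauchyI)
        fix e :: real assume e: "e > 0"
        have "(\<lambda>n. 2 * (\<tau> * (C * \<epsilon> n))) \<longlonglongrightarrow> 2 * (\<tau> * (C * 0))" by (intro tendsto_intros \<epsilon>lim)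
        then have "eventually (\<lambda>n. 2 * (\<tau> * (C * \<epsilon> n)) < e / 2) sequentially"
          by (rule order_tendstoD) (use e in simp)
        then obtain N where N: "\<And>n. n \<ge> N \<Longrightarrow> 2 * (\<tau> * (C * \<epsilon> n)) < e / 2"
          unfolding eventually_sequentially by blast
        have "dist (d m t) (d n t) < e" if "m \<ge> N" "n \<ge> N" for m n
        proof -
          have "dist (d m t) (d n t) \<le> 2 * (\<tau> * (C * \<epsilon> m)) + 2 * (\<tau> * (C * \<epsilon> n))"
            using cauchy[OF t, of m n] by (simp add: dist_norm distrib_left)
          with N[OF that(1)] N[OF that(2)] show ?thesis by linarith
        qed
        then show "\<exists>N. \<forall>m\<ge>N. \<forall>n\<ge>N. dist (d m t) (d n t) < e" by blast
      qed
      then show ?thesis by (simp add: Cauchy_convergent_iff convergent_def)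
    qed
    then obtain l where l: "\<And>t. \<bar>t\<bar> \<le> \<tau> \<Longrightarrow> (\<lambda>n. d n t) \<longlonglongrightarrow> l t" by metis
    have dl: "norm (d n t - l t) \<le> 2 * (\<tau> * (C * \<epsilon> n))" if t: "\<bar>t\<bar> \<le> \<tau>" for n t
    proof (rule LIMSEQ_le)
      show "(\<lambda>m. norm (d n t - d m t)) \<longlonglongrightarrow> norm (d n t - l t)" by (intro tendsto_intros l t)
      have "(\<lambda>m. 2 * (\<tau> * (C * \<epsilon> n + C * \<epsilon> m))) \<longlonglongrightarrow> 2 * (\<tau> * (C * \<epsilon> n + C * 0))"
        by (intro tendsto_intros \<epsilon>lim)
      then show "(\<lambda>m. 2 * (\<tau> * (C * \<epsilon> n + C * \<epsilon> m))) \<longlonglongrightarrow> 2 * (\<tau> * (C * \<epsilon> n))" by simp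
    qed (use cauchy[OF t] in auto)
    define S where "S = {-\<tau><..<\<tau>}"
    have S: "t \<in> S \<longleftrightarrow> \<bar>t\<bar> < \<tau>" for t by (auto simp: S_def)
    have "\<exists>g. \<forall>t\<in>S. (\<lambda>n. d n t) \<longlonglongrightarrow> g t \<and> (g has_derivative (\<lambda>s. s *\<^sub>R G (T t x) (l t))) (at t within S)"
    proof (rule has_derivative_sequence)
      show "convex S" by (simp add: S_def)
      show "(d n has_derivative (\<lambda>s. s *\<^sub>R d' n t)) (at t within S)" if "t \<in> S" for n t
        using dd[of t n] that by (auto simp: S has_vector_derivative_def intro: has_derivative_at_withinI)
      show "0 \<in> S" using \<tau>0 by (simp add: S)
      show "(\<lambda>n. d n 0) \<longlonglongrightarrow> h" by (simp add: d0)
      fix e :: real assume e: "e > 0"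
      have "(\<lambda>n. C * \<epsilon> n + B * (2 * (\<tau> * (C * \<epsilon> n)))) \<longlonglongrightarrow> C * 0 + B * (2 * (\<tau> * (C * 0)))"
        by (intro tendsto_intros \<epsilon>lim)
      then have "eventually (\<lambda>n. C * \<epsilon> n + B * (2 * (\<tau> * (C * \<epsilon> n))) < e) sequentially"
        by (rule order_tendstoD) (use e in simp)
      then show "\<forall>\<^sub>F n in sequentially. \<forall>t\<in>S. \<forall>s. norm (s *\<^sub>R d' n t - s *\<^sub>R G (T t x) (l t)) \<le> e * norm s"
      proof eventually_elim
        case (elim n)
        show ?case
        proof (intro ballI allI)
          fix t s assume "t \<in> S"
          then have t: "\<bar>t\<bar> \<le> \<tau>" by (simp add: S)
          have "d' n t - G (T t x) (l t) = (d' n t - G (T t x) (d n t)) + G (T t x) (d n t - l t)"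
            by (simp add: linear_diff[OF linG[OF Tx[OF t]]])
          then have "norm (d' n t - G (T t x) (l t)) \<le> norm (d' n t - G (T t x) (d n t)) + norm (G (T t x) (d n t - l t))"
            by (simp only: norm_triangle_ineq)
          also have "\<dots> \<le> C * \<epsilon> n + B * (2 * (\<tau> * (C * \<epsilon> n)))"
            using GB[OF Tx[OF t], of "d n t - l t"] mult_left_mono[OF dl[OF t, of n] B]
            by (intro add_mono d'G[OF t]) simp
          also have "\<dots> \<le> e" using elim by simp
          finally have "norm (d' n t - G (T t x) (l t)) \<le> e" .
          from mult_left_mono[OF this, of "\<bar>s\<bar>"]
          show "norm (s *\<^sub>R d' n t - s *\<^sub>R G (T t x) (l t)) \<le> e * norm s"
            by (simp add: scaleR_diff_right[symmetric] mult.commute del: scaleR_diff_right)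
        qed
      qed
    qed
    then obtain g where g: "\<And>t. t \<in> S \<Longrightarrow> (\<lambda>n. d n t) \<longlonglongrightarrow> g t"
      "\<And>t. t \<in> S \<Longrightarrow> (g has_derivative (\<lambda>s. s *\<^sub>R G (T t x) (l t))) (at t within S)" by blast
    have gl: "g t = l t" if "t \<in> S" for t
      using LIMSEQ_unique[OF g(1)[OF that] l[of t]] that by (simp add: S)
    show ?thesis
    proof (intro exI[of _ g] conjI allI impI)
      have "0 \<in> S" using \<tau>0 by (simp add: S)
      from LIMSEQ_unique[OF g(1)[OF this]] show "g 0 = h" by (simp add: d0)
      fix t assume "\<bar>t\<bar> < \<tau>"
      then have t: "t \<in> S" by (simp add: S)
      have "at t within S = at t" using t by (intro at_within_open) (auto simp: S_def)
      with g(2)[OF t] gl[OF t] show "(g has_vector_derivative G (T t x) (g t)) (at t)"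
        by (simp add: has_vector_derivative_def)
    qed
  qed
  then obtain D where D0: "\<And>h. D h 0 = h"
    and D': "\<And>h t. \<bar>t\<bar> < \<tau> \<Longrightarrow> (D h has_vector_derivative G (T t x) (D h t)) (at t)" by metis

  \<comment> \<open>The solutions \<open>D h\<close> live on the open interval of radius \<open>\<tau>\<close>; the Gronwall estimate needs a closed one.\<close>
  define \<sigma> where "\<sigma> = \<tau> / 2"
  have \<sigma>: "\<sigma> > 0" "\<sigma> < \<tau>" using \<tau>0 by (auto simp: \<sigma>_def)
  have B\<sigma>: "B * \<sigma> \<le> 1/2" using \<tau>B mult_left_mono[OF less_imp_le[OF \<sigma>(2)] B] by linarith
  have D_zero: "w t = 0" if "w 0 = 0" "\<And>t. \<bar>t\<bar> \<le> \<sigma> \<Longrightarrow> (w has_vector_derivative G (T t x) (w t)) (at t)" "\<bar>t\<bar> \<le> \<sigma>"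
    for w t
  proof -
    have "norm (w t) \<le> 2 * (norm (w 0) + \<sigma> * 0)"
      by (rule small_time_Gronwall[OF that(2) _ B B\<sigma> _ that(3)])
         (use GB[OF Tx] \<sigma> in auto)
    then show ?thesis using that(1) by simp
  qed
  show ?thesis
  proof (rule that[of \<sigma> "\<lambda>t h. D h t"])
    show "T t x \<in> ball x r" if "\<bar>t\<bar> < \<sigma>" for t using that \<sigma> by (intro Tx) auto
    show "(D h has_vector_derivative G (T t x) (D h t)) (at t)" if "\<bar>t\<bar> < \<sigma>" for t h
      using that \<sigma> by (intro D') auto
    fix t assume t: "\<bar>t\<bar> < \<sigma>"
    have lin: "linear (\<lambda>h. D h t)"
    proof (rule linearI)
      fix h k :: 'a and a :: real
      have "D (h + k) t - (D h t + D k t) = 0"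
      proof (rule D_zero[where w = "\<lambda>t. D (h + k) t - (D h t + D k t)"])
        fix s assume s: "\<bar>s\<bar> \<le> \<sigma>"
        then have s': "\<bar>s\<bar> < \<tau>" "\<bar>s\<bar> \<le> \<tau>" using \<sigma> by auto
        show "((\<lambda>t. D (h + k) t - (D h t + D k t)) has_vector_derivative
            G (T s x) (D (h + k) s - (D h s + D k s))) (at s)"
          unfolding linear_diff[OF linG[OF Tx[OF s'(2)]]] linear_add[OF linG[OF Tx[OF s'(2)]]]
          by (intro has_vector_derivative_diff has_vector_derivative_add D' s')
      qed (use t in \<open>auto simp: D0\<close>)
      then show "D (h + k) t = D h t + D k t" by simp
      have "D (a *\<^sub>R h) t - a *\<^sub>R D h t = 0"
      proof (rule D_zero[where w = "\<lambda>t. D (a *\<^sub>R h) t - a *\<^sub>R D h t"])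
        fix s assume s: "\<bar>s\<bar> \<le> \<sigma>"
        then have s': "\<bar>s\<bar> < \<tau>" "\<bar>s\<bar> \<le> \<tau>" using \<sigma> by auto
        show "((\<lambda>t. D (a *\<^sub>R h) t - a *\<^sub>R D h t) has_vector_derivative
            G (T s x) (D (a *\<^sub>R h) s - a *\<^sub>R D h s)) (at s)"
          unfolding linear_diff[OF linG[OF Tx[OF s'(2)]]] linear_scale[OF linG[OF Tx[OF s'(2)]]]
          by (intro has_vector_derivative_diff D' s'
              bounded_linear.has_vector_derivative[OF bounded_linear_scaleR_right])
      qed (use t in \<open>auto simp: D0\<close>)
      then show "D (a *\<^sub>R h) t = a *\<^sub>R D h t" by simp
    qed
    define C where "C = 8 * L * \<sigma> + 1"
    have C: "C > 0" using L \<sigma> by (simp add: C_def add_nonneg_pos)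
    have quad: "norm (T t y - T t x - D (y - x) t) \<le> C * (norm (y - x))\<^sup>2" if y: "y \<in> ball x (r/2)" for y
    proof -
      have "norm (T t y - T t x - D (y - x) t) \<le>
          2 * (norm (T 0 y - T 0 x - D (y - x) 0) + \<sigma> * (4 * L * (norm (y - x))\<^sup>2))"
      proof (rule small_time_Gronwall[where w = "\<lambda>t. T t y - T t x - D (y - x) t"
            and w' = "\<lambda>t. v (T t y) - v (T t x) - G (T t x) (D (y - x) t)"])
        fix s assume s: "\<bar>s\<bar> \<le> \<sigma>"
        then have s': "\<bar>s\<bar> < \<tau>" "\<bar>s\<bar> \<le> \<tau>" using \<sigma> by auto
        show "((\<lambda>t. T t y - T t x - D (y - x) t) has_vector_derivative
            v (T s y) - v (T s x) - G (T s x) (D (y - x) s)) (at s)"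
          by (intro has_vector_derivative_diff D' derT y x0 s')
        have "v (T s y) - v (T s x) - G (T s x) (D (y - x) s) =
            G (T s x) (T s y - T s x - D (y - x) s) + (v (T s y) - v (T s x) - G (T s x) (T s y - T s x))"
          by (simp add: linear_diff[OF linG[OF Tx[OF s'(2)]]])
        then have "norm (v (T s y) - v (T s x) - G (T s x) (D (y - x) s)) \<le>
            norm (G (T s x) (T s y - T s x - D (y - x) s)) + norm (v (T s y) - v (T s x) - G (T s x) (T s y - T s x))"
          by (simp only: norm_triangle_ineq)
        also have "\<dots> \<le> B * norm (T s y - T s x - D (y - x) s) + 4 * L * (norm (y - x))\<^sup>2"
          by (intro add_mono GB Tx rem y s')
        finally show "norm (v (T s y) - v (T s x) - G (T s x) (D (y - x) s)) \<le>
            B * norm (T s y - T s x - D (y - x) s) + 4 * L * (norm (y - x))\<^sup>2" .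
      qed (use B B\<sigma> L t in auto)
      also have "norm (T 0 y - T 0 x - D (y - x) 0) = 0"
        using y r by (simp add: D0 T0)
      also have "2 * (0 + \<sigma> * (4 * L * (norm (y - x))\<^sup>2)) \<le> C * (norm (y - x))\<^sup>2"
        by (simp add: C_def algebra_simps)
      finally show ?thesis .
    qed
    show "(T t has_derivative (\<lambda>h. D h t)) (at x)"
      unfolding has_derivative_at_alt
    proof (intro conjI allI impI)
      show "bounded_linear (\<lambda>h. D h t)" using lin by (simp add: linear_conv_bounded_linear)
      fix e :: real assume e: "e > 0"
      show "\<exists>d>0. \<forall>y. norm (y - x) < d \<longrightarrow> norm (T t y - T t x - D (y - x) t) \<le> e * norm (y - x)"
      proof (intro exI[of _ "min (r/2) (e / C)"] conjI allI impI)
        show "min (r/2) (e / C) > 0" using r e C by simp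
        fix y assume y: "norm (y - x) < min (r/2) (e / C)"
        then have "norm (T t y - T t x - D (y - x) t) \<le> C * (norm (y - x))\<^sup>2"
          by (intro quad) (simp add: dist_norm norm_minus_commute)
        also have "\<dots> = (C * norm (y - x)) * norm (y - x)" by (simp add: power2_eq_square)
        also have "\<dots> \<le> e * norm (y - x)"
          using y C by (intro mult_right_mono) (auto simp: field_simps)
        finally show "norm (T t y - T t x - D (y - x) t) \<le> e * norm (y - x)" .
      qed
    qed
  qed (use \<sigma> D0 in auto)
qed

lemma norm_matrix_vector_mult_le:
  fixes A :: "real^'n^'m"
  shows "norm (A *v x) \<le> norm A * norm x"
proof -
  have "norm (A *v x) = L2_set (\<lambda>i. \<bar>A $ i \<bullet> x\<bar>) UNIV"
    by (simp add: norm_vec_def matrix_vector_mul_component)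
  also have "\<dots> \<le> L2_set (\<lambda>i. norm (A $ i) * norm x) UNIV"
    by (intro L2_set_mono Cauchy_Schwarz_ineq2) auto
  also have "\<dots> = norm A * norm x"
    by (simp add: L2_set_left_distrib norm_vec_def)
  finally show ?thesis .
qed

text \<open>The matrix form \<open>J' = Dv (T\<^sub>t x) J\<close> of the linearised flow equation. The norm of matrices dominates
  the operator norm, so the Lipschitz condition on the Jacobian provides all bounds on a small ball.\<close>

lemma flow_jacobian_variation:
  fixes v :: "real^'n \<Rightarrow> real^'n"
  assumes W: "open W" "x \<in> W" and \<delta>: "\<delta> > 0" and dv: "\<And>y. y \<in> W \<Longrightarrow> v differentiable (at y)"
    and lip: "e > 0" "L-lipschitz_on (ball x e) (\<lambda>y. jacobian v (at y))"
    and T0: "\<And>y. y \<in> W \<Longrightarrow> T 0 y = y"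
    and T': "\<And>y t. y \<in> W \<Longrightarrow> \<bar>t\<bar> < \<delta> \<Longrightarrow> ((\<lambda>s. T s y) has_vector_derivative v (T t y)) (at t)"
  obtains \<tau> where "\<tau> > 0" "jacobian (T 0) (at x) = mat 1"
    "\<And>t. \<bar>t\<bar> < \<tau> \<Longrightarrow> T t x \<in> W"
    "\<And>t i j. \<bar>t\<bar> < \<tau> \<Longrightarrow> ((\<lambda>s. jacobian (T s) (at x) $ i $ j) has_real_derivative
       (jacobian v (at (T t x)) ** jacobian (T t) (at x)) $ i $ j) (at t)"
proof -
  define G where "G = (\<lambda>y. jacobian v (at y))"
  obtain d where d: "d > 0" "ball x d \<subseteq> W" using W openE by blast
  define r where "r = min d e"
  have r: "r > 0" "ball x r \<subseteq> W" "ball x r \<subseteq> ball x e" using d lip(1) by (auto simp: r_def)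
  have L: "L \<ge> 0" using lipschitz_on_nonneg[OF lip(2)] .
  have GL: "norm (G y - G z) \<le> L * norm (y - z)" if "y \<in> ball x r" "z \<in> ball x r" for y z
    using lipschitz_onD[OF lip(2), of y z] that r(3) by (auto simp: dist_norm G_def subset_iff)
  have GB: "norm (G y) \<le> norm (G x) + L * r" if y: "y \<in> ball x r" for y
  proof -
    have "norm (G y) \<le> norm (G x) + norm (G y - G x)" by (rule norm_triangle_sub)
    also have "norm (G y - G x) \<le> L * norm (y - x)" using y r(1) by (intro GL) auto
    also have "L * norm (y - x) \<le> L * r"
      using y L by (intro mult_left_mono) (auto simp: dist_norm norm_minus_commute)
    finally show ?thesis by simp
  qed
  show ?thesis
  proof (rule flow_differentiable[of r \<delta> L "norm (G x) + L * r" x v "\<lambda>y h. G y *v h" T])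
    show "0 \<le> norm (G x) + L * r" using L r(1) by simp
    show "(v has_derivative (\<lambda>h. G y *v h)) (at y)" if "y \<in> ball x r" for y
      using dv[of y] that r(2) by (auto simp: jacobian_works G_def)
    show "norm (G y *v h) \<le> (norm (G x) + L * r) * norm h" if "y \<in> ball x r" for y h
      using norm_matrix_vector_mult_le[of "G y" h] mult_right_mono[OF GB[OF that], of "norm h"] by simp
    show "norm (G y *v h - G z *v h) \<le> L * norm (y - z) * norm h"
      if "y \<in> ball x r" "z \<in> ball x r" for y z h
    proof -
      have "norm ((G y - G z) *v h) \<le> norm (G y - G z) * norm h" by (rule norm_matrix_vector_mult_le)
      also have "\<dots> \<le> L * norm (y - z) * norm h" by (rule mult_right_mono[OF GL[OF that]]) simp
      finally show ?thesis by (simp add: matrix_vector_mult_diff_rdistrib)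
    qed
    show "T 0 y = y" if "y \<in> ball x r" for y using T0 that r(2) by auto
    show "((\<lambda>s. T s y) has_vector_derivative v (T t y)) (at t)" if "y \<in> ball x r" "\<bar>t\<bar> < \<delta>" for y t
      using T' that r(2) by auto
    fix \<tau> J assume \<tau>: "\<tau> > 0" and J0: "\<And>h. J 0 h = h" and Tx: "\<And>t. \<bar>t\<bar> < \<tau> \<Longrightarrow> T t x \<in> ball x r"
      and TJ: "\<And>t. \<bar>t\<bar> < \<tau> \<Longrightarrow> (T t has_derivative J t) (at x)"
      and J': "\<And>t h. \<bar>t\<bar> < \<tau> \<Longrightarrow> ((\<lambda>s. J s h) has_vector_derivative G (T t x) *v J t h) (at t)"
    have jac: "jacobian (T t) (at x) *v h = J t h" if "\<bar>t\<bar> < \<tau>" for t h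
    proof -
      have "T t differentiable (at x)" using TJ[OF that] by (rule differentiableI)
      then have "(T t has_derivative (\<lambda>h. jacobian (T t) (at x) *v h)) (at x)" by (simp add: jacobian_works)
      from has_derivative_unique[OF this TJ[OF that]] show ?thesis by (rule fun_cong)
    qed
    have jac_ij: "jacobian (T t) (at x) $ i $ j = J t (axis j 1) $ i" if "\<bar>t\<bar> < \<tau>" for t i j
      using jac[OF that, of "axis j 1"] by (simp add: matrix_vector_mult_basis column_def vec_eq_iff)
    show ?thesis
    proof (rule that[OF \<tau>])
      show "jacobian (T 0) (at x) = mat 1"
        using jac_ij[of 0] \<tau> J0 by (simp add: vec_eq_iff mat_def axis_def)
      show "T t x \<in> W" if "\<bar>t\<bar> < \<tau>" for t using Tx[OF that] r(2) by auto
      fix t i j assume t: "\<bar>t\<bar> < \<tau>"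
      have "((\<lambda>s. J s (axis j 1) $ i) has_vector_derivative (G (T t x) *v J t (axis j 1)) $ i) (at t)"
        by (rule bounded_linear.has_vector_derivative[OF bounded_linear_vec_nth J'[OF t]])
      moreover have "(G (T t x) *v J t (axis j 1)) $ i = (G (T t x) ** jacobian (T t) (at x)) $ i $ j"
        unfolding jac[OF t, symmetric]
        by (simp add: matrix_vector_mul_assoc) (simp add: matrix_vector_mult_basis column_def)
      moreover have "eventually (\<lambda>s. jacobian (T s) (at x) $ i $ j = J s (axis j 1) $ i) (nhds t)"
      proof -
        have "eventually (\<lambda>s. s \<in> {-\<tau><..<\<tau>}) (nhds t)"
          using t by (intro eventually_nhds_in_open) auto
        then show ?thesis by eventually_elim (rule jac_ij, auto)
      qed
      ultimately show "((\<lambda>s. jacobian (T s) (at x) $ i $ j) has_real_derivative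
          (jacobian v (at (T t x)) ** jacobian (T t) (at x)) $ i $ j) (at t)"
        by (subst DERIV_cong_ev[OF refl _ refl]) (auto simp: has_real_derivative_iff_has_vector_derivative G_def)
    qed
  qed (use r L \<delta> in auto)
qed

section \<open>Determinant and inverse along a linear matrix equation\<close>

lemma has_vector_derivative_vecI:
  fixes f :: "real \<Rightarrow> real^'n"
  assumes "\<And>i. ((\<lambda>s. f s $ i) has_real_derivative d $ i) (at t)"
  shows "(f has_vector_derivative d) (at t)"
  unfolding has_vector_derivative_def
proof (subst has_derivative_componentwise_within, intro ballI)
  fix b :: "real^'n" assume "b \<in> Basis"
  then obtain i where "b = axis i 1" by (auto simp: Basis_vec_def)
  then show "((\<lambda>s. f s \<bullet> b) has_derivative (\<lambda>s. (s *\<^sub>R d) \<bullet> b)) (at t)"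
    using assms[of i] by (simp add: inner_axis has_field_derivative_def mult.commute[of "d $ i"] mult_commute_abs)
qed

lemma bounded_linear_trace: "bounded_linear (trace :: real^'n^'n \<Rightarrow> real)"
proof -
  have "linear (trace :: real^'n^'n \<Rightarrow> real)"
    by (rule linearI) (auto simp: trace_def sum.distrib sum_distrib_left)
  then show ?thesis by (simp add: linear_conv_bounded_linear)
qed

lemma trace_square_symmetric:
  fixes M :: "real^'n^'n"
  assumes "transpose M = M"
  shows "trace (M ** M) = frob M M"
proof -
  have "M $ j $ i = M $ i $ j" for i j using assms by (metis transpose_def vec_lambda_beta)
  then show ?thesis by (simp add: trace_def frob_def matrix_matrix_mult_def)
qed

text \<open>In the Leibniz expansion a permutation other than the identity moves at least two points, so after
  differentiating one factor another one still vanishes at the unit matrix.\<close>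

lemma det_has_derivative_at_identity:
  fixes B :: "real \<Rightarrow> real^'n^'n"
  assumes der: "\<And>i j. ((\<lambda>s. B s $ i $ j) has_real_derivative B' $ i $ j) (at t)" and id: "B t = mat 1"
  shows "((\<lambda>s. det (B s)) has_real_derivative trace B') (at t)"
proof -
  let ?P = "{p. p permutes (UNIV :: 'n set)}"
  define c where "c = (\<lambda>p :: 'n \<Rightarrow> 'n. of_int (sign p) *
      (\<Sum>i\<in>UNIV. B' $ i $ p i * (\<Prod>j\<in>UNIV - {i}. B t $ j $ p j)))"
  have "((\<lambda>s. det (B s)) has_real_derivative (\<Sum>p\<in>?P. c p)) (at t)"
    unfolding det_def c_def
    by (intro DERIV_sum DERIV_cmult has_field_derivative_prod der)
  moreover have "c p = 0" if p: "p \<in> ?P" "p \<noteq> id" for p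
  proof -
    have zero: "(\<Prod>j\<in>UNIV - {i}. B t $ j $ p j) = 0" for i
    proof -
      have "\<exists>j. j \<noteq> i \<and> p j \<noteq> j"
      proof (rule ccontr)
        assume "\<not> ?thesis"
        then have fix_others: "\<And>j. j \<noteq> i \<Longrightarrow> p j = j" by blast
        have "inj p" using p(1) by (auto intro: permutes_inj)
        then have "p i = i" using fix_others by (metis injD)
        with fix_others p(2) show False by (metis eq_id_iff)
      qed
      then obtain j where "j \<in> UNIV - {i}" "B t $ j $ p j = 0" by (auto simp: id mat_def)
      then show ?thesis by (intro prod_zero bexI[of _ j]) auto
    qed
    show ?thesis by (simp only: c_def zero mult_zero_right sum.neutral_const)
  qed
  then have "(\<Sum>p\<in>?P. c p) = (\<Sum>p\<in>{id}. c p)"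
    by (intro sum.mono_neutral_right) (auto simp: finite_permutations permutes_id)
  moreover have "c id = trace B'"
    by (simp add: c_def trace_def id mat_def)
  ultimately show ?thesis by simp
qed

lemma matrix_mult_const_has_derivative:
  fixes J :: "real \<Rightarrow> real^'n^'m" and C :: "real^'k^'n"
  assumes "\<And>i j. ((\<lambda>s. J s $ i $ j) has_real_derivative J' $ i $ j) (at t)"
  shows "((\<lambda>s. (J s ** C) $ i $ j) has_real_derivative (J' ** C) $ i $ j) (at t)"
  unfolding matrix_matrix_mult_def using assms
  by (auto intro!: derivative_eq_intros)

lemma matrix_inv_works:
  fixes A :: "real^'n^'n"
  assumes "det A \<noteq> 0"
  shows "A ** matrix_inv A = mat 1" "matrix_inv A ** A = mat 1"
proof -
  have "\<exists>A'. A ** A' = mat 1 \<and> A' ** A = mat 1"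
    using assms invertible_det_nz[of A] unfolding invertible_def by blast
  then have "A ** matrix_inv A = mat 1 \<and> matrix_inv A ** A = mat 1"
    unfolding matrix_inv_def by (rule someI_ex)
  then show "A ** matrix_inv A = mat 1" "matrix_inv A ** A = mat 1" by auto
qed

text \<open>Multiplying by the fixed matrix \<open>matrix_inv (J t)\<close> reduces to a curve through the unit matrix.\<close>

lemma Liouville_det:
  fixes J :: "real \<Rightarrow> real^'n^'n"
  assumes der: "\<And>i j. ((\<lambda>s. J s $ i $ j) has_real_derivative (A ** J t) $ i $ j) (at t)"
    and inv: "det (J t) \<noteq> 0"
  shows "((\<lambda>s. det (J s)) has_real_derivative trace A * det (J t)) (at t)"
proof -
  let ?M = "matrix_inv (J t)"
  have "((\<lambda>s. det (J s ** ?M)) has_real_derivative trace (A ** J t ** ?M)) (at t)"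
    by (intro det_has_derivative_at_identity matrix_mult_const_has_derivative der)
       (simp add: matrix_inv_works[OF inv])
  then have "((\<lambda>s. det (J s ** ?M)) has_real_derivative trace A) (at t)"
    by (simp add: matrix_mul_assoc[symmetric] matrix_inv_works[OF inv])
  then have "((\<lambda>s. det (J s ** ?M) * det (J t)) has_real_derivative trace A * det (J t)) (at t)"
    by (rule DERIV_cmult_right)
  moreover have "det (J s ** ?M) * det (J t) = det (J s)" for s
  proof -
    have "det (J s ** ?M) * det (J t) = det (J s ** ?M ** J t)" by (simp add: det_mul)
    then show ?thesis by (simp add: matrix_mul_assoc[symmetric] matrix_inv_works[OF inv])
  qed
  ultimately show ?thesis by simp
qed

lemma det_differentiable:
  fixes J :: "real \<Rightarrow> real^'n^'n"
  assumes "\<And>i j. (\<lambda>s. J s $ i $ j) field_differentiable (at t)"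
  shows "(\<lambda>s. det (J s)) field_differentiable (at t)"
proof -
  obtain J' where J': "\<And>i j. ((\<lambda>s. J s $ i $ j) has_real_derivative J' i j) (at t)"
    using assms unfolding field_differentiable_def by metis
  have "((\<lambda>s. det (J s)) has_real_derivative (\<Sum>p\<in>{p. p permutes (UNIV :: 'n set)}. of_int (sign p) *
      (\<Sum>i\<in>UNIV. J' i (p i) * (\<Prod>j\<in>UNIV - {i}. J t $ j $ p j)))) (at t)"
    unfolding det_def by (intro DERIV_sum DERIV_cmult has_field_derivative_prod J')
  then show ?thesis unfolding field_differentiable_def by blast
qed

lemma matrix_inv_entry_Cramer:
  fixes A :: "real^'n^'n"
  assumes "det A \<noteq> 0"
  shows "matrix_inv A $ i $ j = det (\<chi> r c. if c = i then axis j 1 $ r else A $ r $ c) / det A"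
proof -
  let ?x = "matrix_inv A *v axis j 1"
  have "A *v ?x = axis j 1"
    by (simp add: matrix_vector_mul_assoc matrix_inv_works[OF assms])
  then have "?x = (\<chi> k. det (\<chi> r c. if c = k then axis j 1 $ r else A $ r $ c) / det A)"
    by (simp add: cramer[OF assms])
  moreover have "?x $ i = matrix_inv A $ i $ j"
    by (simp add: matrix_vector_mult_basis column_def)
  ultimately show ?thesis by simp
qed

text \<open>By Cramer's rule the entries of the inverse are differentiable; their derivative is then found by
  differentiating \<open>matrix_inv (J s) ** J s = mat 1\<close>.\<close>

lemma matrix_inv_has_derivative:
  fixes J :: "real \<Rightarrow> real^'n^'n"
  assumes der: "\<And>i j. ((\<lambda>s. J s $ i $ j) has_real_derivative (A ** J t) $ i $ j) (at t)"
    and inv: "det (J t) \<noteq> 0"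
  shows "((\<lambda>s. matrix_inv (J s) $ i $ j) has_real_derivative - (matrix_inv (J t) ** A) $ i $ j) (at t)"
proof -
  have fd: "(\<lambda>s. J s $ i $ j) field_differentiable (at t)" for i j
    using der unfolding field_differentiable_def by blast
  have dd: "(\<lambda>s. det (J s)) field_differentiable (at t)" by (rule det_differentiable[OF fd])
  then have "continuous (at t) (\<lambda>s. det (J s))" by (rule field_differentiable_imp_continuous_at)
  then have nz: "eventually (\<lambda>s. det (J s) \<noteq> 0) (nhds t)"
    using inv by (simp add: continuous_within tendsto_imp_eventually_ne eventually_nhds_conv_at)
  have "(\<lambda>s. matrix_inv (J s) $ i $ j) field_differentiable (at t)" for i j
  proof -
    have "(\<lambda>s. det (\<chi> r c. if c = i then axis j 1 $ r else J s $ r $ c)) field_differentiable (at t)"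
    proof (rule det_differentiable)
      fix r c
      show "(\<lambda>s. (\<chi> r c. if c = i then axis j 1 $ r else J s $ r $ c) $ r $ c) field_differentiable (at t)"
        by (cases "c = i") (auto intro: fd)
    qed
    with dd inv have "(\<lambda>s. det (\<chi> r c. if c = i then axis j 1 $ r else J s $ r $ c) / det (J s)) field_differentiable (at t)"
      by (intro field_differentiable_divide)
    then obtain d where "((\<lambda>s. det (\<chi> r c. if c = i then axis j 1 $ r else J s $ r $ c) / det (J s))
        has_real_derivative d) (at t)" unfolding field_differentiable_def by blast
    then have "((\<lambda>s. matrix_inv (J s) $ i $ j) has_real_derivative d) (at t)"
      by (subst DERIV_cong_ev[OF refl _ refl]) (use nz in \<open>auto elim: eventually_mono simp: matrix_inv_entry_Cramer\<close>)
    then show ?thesis unfolding field_differentiable_def by blast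
  qed
  then obtain N where N: "\<And>i j. ((\<lambda>s. matrix_inv (J s) $ i $ j) has_real_derivative N i j) (at t)"
    unfolding field_differentiable_def by metis
  let ?N = "\<chi> i j. N i j" and ?M = "matrix_inv (J t)"
  have "?N ** J t + ?M ** (A ** J t) = 0"
  proof -
    have "(?N ** J t + ?M ** (A ** J t)) $ i $ j = 0" for i j
    proof -
      have "((\<lambda>s. (matrix_inv (J s) ** J s) $ i $ j) has_real_derivative (?N ** J t + ?M ** (A ** J t)) $ i $ j) (at t)"
        unfolding matrix_matrix_mult_def[of "matrix_inv _"] matrix_matrix_mult_def[of ?N]
        by (auto intro!: derivative_eq_intros N der simp: sum.distrib[symmetric] algebra_simps)
      moreover have "((\<lambda>s. (matrix_inv (J s) ** J s) $ i $ j) has_real_derivative 0) (at t)"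
      proof -
        have "eventually (\<lambda>s. (matrix_inv (J s) ** J s) $ i $ j = (mat 1 :: real^'n^'n) $ i $ j) (nhds t)"
          using nz by eventually_elim (simp add: matrix_inv_works)
        then show ?thesis by (subst DERIV_cong_ev[OF refl _ refl]) auto
      qed
      ultimately show ?thesis by (rule DERIV_unique)
    qed
    then show ?thesis by (simp add: vec_eq_iff)
  qed
  then have "(?N ** J t + ?M ** (A ** J t)) ** ?M = 0" by simp
  moreover have "(X + Y) ** Z = X ** Z + Y ** Z" for X Y Z :: "real^'n^'n"
    by (simp add: matrix_matrix_mult_def vec_eq_iff sum.distrib distrib_right)
  ultimately have "?N + ?M ** A = 0"
    by (simp add: matrix_mul_assoc[symmetric] matrix_inv_works[OF inv])
  then have "N i j = - (?M ** A) $ i $ j"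
    by (simp add: vec_eq_iff add_eq_0_iff)
  with N[of i j] show ?thesis by simp
qed

lemma matrix_inv_mat_1: "matrix_inv (mat 1 :: real^'n^'n) = mat 1"
  using matrix_inv_works(1)[of "mat 1 :: real^'n^'n"] by simp

text \<open>The second derivative of \<open>f\<close> at \<open>x\<close> depends on the first one only near \<open>x\<close>, where it is given by \<open>g\<close>.\<close>

lemma deriv_twice_eqI:
  assumes "eventually (\<lambda>t. (f has_real_derivative g t) (at t)) (nhds x)"
    and "(g has_real_derivative d) (at x)"
  shows "deriv f x = g x" "(deriv ^^ 2) f x = d"
proof -
  show "deriv f x = g x"
    using eventually_nhds_x_imp_x[OF assms(1)] by (rule DERIV_imp_deriv)
  have "eventually (\<lambda>t. deriv f t = g t) (nhds x)"
    using assms(1) by eventually_elim (rule DERIV_imp_deriv)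
  then have "deriv (deriv f) x = deriv g x" by (rule deriv_cong_ev) simp
  then show "(deriv ^^ 2) f x = d"
    using DERIV_imp_deriv[OF assms(2)] by (simp add: numeral_2_eq_2)
qed

text \<open>With \<open>p = transpose (matrix_inv (J t)) *v \<xi>\<close> the function \<open>q\<close> is \<open>|p|\<^sup>2 det J\<close>, and
  \<open>p' = - A p\<close>. So near \<open>0\<close> the first derivatives are expressed by \<open>A\<close>, \<open>p\<close> and \<open>det J\<close> alone, and one
  more differentiation at \<open>0\<close> uses the derivative \<open>A'\<close> of \<open>A\<close> only there. That is
  exactly what is known almost everywhere for a Hessian that is merely Lipschitz.\<close>

lemma transported_densities_derivatives:
  fixes J A :: "real \<Rightarrow> real^'n^'n" and \<xi> :: "real^'n"
  assumes \<tau>: "\<tau> > 0" and J0: "J 0 = mat 1"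
    and derJ: "\<And>t i j. \<bar>t\<bar> < \<tau> \<Longrightarrow> ((\<lambda>s. J s $ i $ j) has_real_derivative (A t ** J t) $ i $ j) (at t)"
    and sym: "\<And>t. \<bar>t\<bar> < \<tau> \<Longrightarrow> transpose (A t) = A t"
    and derA: "(A has_vector_derivative A') (at 0)"
  defines "H \<equiv> A 0"
  defines "q \<equiv> \<lambda>t. bil (matrix_inv (J t) ** transpose (matrix_inv (J t))) \<xi> \<xi> * det (J t)"
  shows "deriv (\<lambda>t. det (J t)) 0 = trace H"
    and "(deriv ^^ 2) (\<lambda>t. det (J t)) 0 = trace A' + (trace H)\<^sup>2"
    and "deriv q 0 = - 2 * (\<xi> \<bullet> (H *v \<xi>)) + trace H * (\<xi> \<bullet> \<xi>)"
    and "(deriv ^^ 2) q 0 = 4 * ((H *v \<xi>) \<bullet> (H *v \<xi>)) - 2 * (\<xi> \<bullet> (A' *v \<xi>))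
           - 4 * trace H * (\<xi> \<bullet> (H *v \<xi>)) + (trace A' + (trace H)\<^sup>2) * (\<xi> \<bullet> \<xi>)"
proof -
  have "(\<lambda>s. det (J s)) field_differentiable (at 0)"
    using derJ[of 0] \<tau> by (intro det_differentiable) (auto simp: field_differentiable_def)
  then have "continuous (at 0) (\<lambda>s. det (J s))" by (rule field_differentiable_imp_continuous_at)
  then have nz: "eventually (\<lambda>s. det (J s) \<noteq> 0) (nhds 0)"
    by (simp add: continuous_within tendsto_imp_eventually_ne eventually_nhds_conv_at J0)
  have "eventually (\<lambda>s. \<bar>s\<bar> < \<tau>) (nhds 0)"
    using \<tau> by (auto simp: eventually_nhds_metric dist_real_def)
  with nz have good: "eventually (\<lambda>t. det (J t) \<noteq> 0 \<and> \<bar>t\<bar> < \<tau>) (nhds 0)"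
    by eventually_elim simp
  define a where "a = (\<lambda>t. det (J t))"
  have a': "(a has_real_derivative trace (A t) * a t) (at t)" if "det (J t) \<noteq> 0 \<and> \<bar>t\<bar> < \<tau>" for t
    unfolding a_def using that derJ by (intro Liouville_det) auto
  define p where "p = (\<lambda>t. transpose (matrix_inv (J t)) *v \<xi>)"
  have p': "(p has_vector_derivative - (A t *v p t)) (at t)" if t: "det (J t) \<noteq> 0 \<and> \<bar>t\<bar> < \<tau>" for t
  proof (rule has_vector_derivative_vecI)
    fix i
    have "((\<lambda>s. \<Sum>j\<in>UNIV. matrix_inv (J s) $ j $ i * \<xi> $ j) has_real_derivative
        (\<Sum>j\<in>UNIV. - (matrix_inv (J t) ** A t) $ j $ i * \<xi> $ j)) (at t)"
      using t derJ by (intro DERIV_sum DERIV_cmult_right matrix_inv_has_derivative) auto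
    moreover have "(\<Sum>j\<in>UNIV. - (matrix_inv (J t) ** A t) $ j $ i * \<xi> $ j) = - (transpose (matrix_inv (J t) ** A t) *v \<xi>) $ i"
      by (simp add: matrix_vector_mult_def transpose_def sum_negf del: transpose_matrix_vector)
    moreover have "transpose (matrix_inv (J t) ** A t) *v \<xi> = A t *v p t"
      using sym[of t] t by (simp add: p_def matrix_transpose_mul matrix_vector_mul_assoc del: transpose_matrix_vector)
    moreover have "(\<lambda>s. p s $ i) = (\<lambda>s. \<Sum>j\<in>UNIV. matrix_inv (J s) $ j $ i * \<xi> $ j)"
      by (simp add: p_def matrix_vector_mult_def transpose_def del: transpose_matrix_vector)
    ultimately show "((\<lambda>s. p s $ i) has_real_derivative (- (A t *v p t)) $ i) (at t)" by simp
  qed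
  have q_eq: "q = (\<lambda>t. (p t \<bullet> p t) * a t)"
  proof
    fix t
    have "\<xi> \<bullet> (M *v (transpose M *v \<xi>)) = (transpose M *v \<xi>) \<bullet> (transpose M *v \<xi>)" for M :: "real^'n^'n"
      by (simp add: dot_lmul_matrix[symmetric])
    then show "q t = (p t \<bullet> p t) * a t"
      by (simp add: q_def p_def a_def bil_def matrix_vector_mul_assoc[symmetric] del: transpose_matrix_vector)
  qed
  have pp': "((\<lambda>s. p s \<bullet> p s) has_real_derivative - 2 * (p t \<bullet> (A t *v p t))) (at t)"
    if t: "det (J t) \<noteq> 0 \<and> \<bar>t\<bar> < \<tau>" for t
    using bounded_bilinear.has_vector_derivative[OF bounded_bilinear_inner p'[OF t] p'[OF t]]
    by (simp add: has_real_derivative_iff_has_vector_derivative inner_commute)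
  define q1 where "q1 = (\<lambda>t. (- 2 * (p t \<bullet> (A t *v p t)) + trace (A t) * (p t \<bullet> p t)) * a t)"
  have q': "(q has_real_derivative q1 t) (at t)" if t: "det (J t) \<noteq> 0 \<and> \<bar>t\<bar> < \<tau>" for t
    unfolding q_eq q1_def using DERIV_mult[OF pp'[OF t] a'[OF t]] by (simp add: algebra_simps)
  have good0: "det (J 0) \<noteq> 0 \<and> \<bar>0\<bar> < \<tau>" using eventually_nhds_x_imp_x[OF good] .
  have p0: "p 0 = \<xi>" by (simp add: p_def J0 matrix_inv_mat_1)
  have a0: "a 0 = 1" by (simp add: a_def J0)
  have trA': "((\<lambda>t. trace (A t)) has_real_derivative trace A') (at 0)"
    using bounded_linear.has_vector_derivative[OF bounded_linear_trace derA]
    by (simp add: has_real_derivative_iff_has_vector_derivative)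
  have p'0: "(p has_vector_derivative - (H *v \<xi>)) (at 0)"
    using p'[OF good0] by (simp add: p0 H_def)
  have a'0: "(a has_real_derivative trace H) (at 0)"
    using a'[OF good0] by (simp add: a0 H_def)
  have Ap': "((\<lambda>t. A t *v p t) has_vector_derivative (H *v - (H *v \<xi>) + A' *v \<xi>)) (at 0)"
    using bounded_bilinear.has_vector_derivative[OF bounded_bilinear_matrix_vector_mult derA p'0]
    by (simp add: p0 H_def)
  have symH: "\<xi> \<bullet> (H *v (H *v \<xi>)) = (H *v \<xi>) \<bullet> (H *v \<xi>)"
    using \<tau> by (intro inner_matrix_vector_symmetric) (simp add: H_def sym)
  have pAp': "((\<lambda>t. p t \<bullet> (A t *v p t)) has_real_derivative
      \<xi> \<bullet> (A' *v \<xi>) - 2 * ((H *v \<xi>) \<bullet> (H *v \<xi>))) (at 0)"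
  proof -
    have "((\<lambda>t. p t \<bullet> (A t *v p t)) has_vector_derivative
        p 0 \<bullet> (H *v - (H *v \<xi>) + A' *v \<xi>) + (- (H *v \<xi>)) \<bullet> (A 0 *v p 0)) (at 0)"
      by (rule bounded_bilinear.has_vector_derivative[OF bounded_bilinear_inner p'0 Ap'])
    moreover have "H *v - (H *v \<xi>) = - (H *v (H *v \<xi>))"
      using linear_neg[OF matrix_vector_mul_linear] by blast
    ultimately show ?thesis
      by (simp add: has_real_derivative_iff_has_vector_derivative p0 H_def[symmetric] inner_add_right inner_diff_right symH)
  qed
  have pp'0: "((\<lambda>s. p s \<bullet> p s) has_real_derivative - 2 * (\<xi> \<bullet> (H *v \<xi>))) (at 0)"
    using pp'[OF good0] by (simp add: p0 H_def)
  have q1': "(q1 has_real_derivative 4 * ((H *v \<xi>) \<bullet> (H *v \<xi>)) - 2 * (\<xi> \<bullet> (A' *v \<xi>))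
           - 4 * trace H * (\<xi> \<bullet> (H *v \<xi>)) + (trace A' + (trace H)\<^sup>2) * (\<xi> \<bullet> \<xi>)) (at 0)"
    unfolding q1_def
    by (rule DERIV_cong[OF DERIV_mult[OF DERIV_add[OF DERIV_cmult[OF pAp'] DERIV_mult[OF trA' pp'0]] a'0]])
      (simp add: p0 a0 H_def[symmetric] power2_eq_square algebra_simps)
  have a2': "((\<lambda>t. trace (A t) * a t) has_real_derivative trace A' + (trace H)\<^sup>2) (at 0)"
    by (rule DERIV_cong[OF DERIV_mult[OF trA' a'0]]) (simp add: a0 H_def[symmetric] power2_eq_square)
  have eva: "eventually (\<lambda>t. (a has_real_derivative trace (A t) * a t) (at t)) (nhds 0)"
    using good by eventually_elim (rule a')
  have evq: "eventually (\<lambda>t. (q has_real_derivative q1 t) (at t)) (nhds 0)"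
    using good by eventually_elim (rule q')
  show "deriv (\<lambda>t. det (J t)) 0 = trace H" "(deriv ^^ 2) (\<lambda>t. det (J t)) 0 = trace A' + (trace H)\<^sup>2"
    using deriv_twice_eqI[OF eva a2'] by (simp_all add: a_def J0 H_def)
  show "deriv q 0 = - 2 * (\<xi> \<bullet> (H *v \<xi>)) + trace H * (\<xi> \<bullet> \<xi>)"
    using deriv_twice_eqI(1)[OF evq q1'] by (simp add: q1_def p0 a0 H_def)
  show "(deriv ^^ 2) q 0 = 4 * ((H *v \<xi>) \<bullet> (H *v \<xi>)) - 2 * (\<xi> \<bullet> (A' *v \<xi>))
           - 4 * trace H * (\<xi> \<bullet> (H *v \<xi>)) + (trace A' + (trace H)\<^sup>2) * (\<xi> \<bullet> \<xi>)"
    using deriv_twice_eqI(2)[OF evq q1'] .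
qed

section \<open>The variation formulas\<close>

text \<open>By completeness of Lebesgue measure \<open>f\<close> is measurable exactly if \<open>g\<close> is; if neither is, both
  integrals have the default value \<open>0\<close>. So the integrands, which contain derivatives that exist only
  almost everywhere, can be exchanged without a measurability argument for them.\<close>

lemma lebesgue_on_integral_cong_AE:
  fixes f g :: "'a::euclidean_space \<Rightarrow> real"
  assumes S: "S \<in> sets lebesgue" and eq: "AE x in lebesgue_on S. f x = g x"
  shows "(LINT x|lebesgue_on S. f x) = (LINT x|lebesgue_on S. g x)"
proof -
  have transfer: "g \<in> borel_measurable (lebesgue_on S)"
    if f: "f \<in> borel_measurable (lebesgue_on S)" and eq: "AE x in lebesgue_on S. f x = g x"
    for f g :: "'a \<Rightarrow> real"
  proof (rule measurableI)
    fix B :: "real set" assume B: "B \<in> sets borel"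
    have "f -` B \<inter> S \<in> sets (lebesgue_on S)" using measurable_sets[OF f B] by simp
    then have fB: "f -` B \<inter> S \<in> sets lebesgue" using S by (simp add: sets_restrict_space_iff)
    have "AE x in lebesgue. x \<in> S \<longrightarrow> f x = g x" using eq S by (simp add: AE_restrict_space_iff)
    then have "AE x in lebesgue. x \<in> f -` B \<inter> S \<longleftrightarrow> x \<in> g -` B \<inter> S" by eventually_elim auto
    from completion.in_sets_AE[OF this fB] have "g -` B \<inter> S \<in> sets lebesgue" by simp
    then show "g -` B \<inter> space (lebesgue_on S) \<in> sets (lebesgue_on S)"
      using S by (simp add: sets_restrict_space_iff)
  qed simp
  show ?thesis
  proof (cases "f \<in> borel_measurable (lebesgue_on S)")
    case True
    with transfer[OF True eq] eq show ?thesis by (intro integral_cong_AE)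
  next
    case False
    moreover have "g \<notin> borel_measurable (lebesgue_on S)"
    proof
      assume "g \<in> borel_measurable (lebesgue_on S)"
      moreover have "AE x in lebesgue_on S. g x = f x" using eq by eventually_elim simp
      ultimately show False using transfer False by blast
    qed
    ultimately show ?thesis
      by (metis borel_measurable_integrable not_integrable_integral_eq)
  qed
qed

text \<open>Along the trajectory of \<open>x\<close> the Hessian \<open>A t\<close> of \<open>\<mu>\<close> has derivative \<open>D (v x)\<close> at \<open>0\<close>, by the chain
  rule, and \<open>D (v x) = K / 2 - H ** H\<close>.\<close>

lemma pointwise_variation:
  fixes v :: "real^'n \<Rightarrow> real^'n" and x \<xi> :: "real^'n"
  assumes U: "open U" and \<Omega>: "open \<Omega>" "\<Omega> \<subseteq> U" "x \<in> \<Omega>"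
    and pot: "\<And>y. y \<in> U \<Longrightarrow> (\<mu> has_derivative (\<lambda>h. v y \<bullet> h)) (at y)"
    and dv: "\<And>y. y \<in> U \<Longrightarrow> v differentiable (at y)"
    and lip: "e > 0" "L-lipschitz_on (ball x e) (\<lambda>y. jacobian v (at y))"
    and d2v: "(\<lambda>y. jacobian v (at y)) differentiable (at x)"
    and flow: "\<delta> > 0" "is_flow v U \<Omega> \<delta> T"
  defines "H \<equiv> hessian \<mu> x" and "K \<equiv> hessian (\<lambda>x. (norm (grad \<mu> x))\<^sup>2) x"
    and "q \<equiv> \<lambda>t. bil (Qmat T t x) \<xi> \<xi> * Jac T t x"
  shows "deriv (\<lambda>t. Jac T t x) 0 = trace H"
    and "(deriv ^^ 2) (\<lambda>t. Jac T t x) 0 = (trace H)\<^sup>2 + trace K / 2 - frob H H"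
    and "deriv q 0 = bil (- 2 *\<^sub>R H + trace H *\<^sub>R mat 1) \<xi> \<xi>"
    and "(deriv ^^ 2) q 0 = bil (6 *\<^sub>R (H ** H) - K - (4 * trace H) *\<^sub>R H
                   + ((trace H)\<^sup>2 + trace K / 2 - frob H H) *\<^sub>R mat 1) \<xi> \<xi>"
proof -
  have xU: "x \<in> U" using \<Omega> by auto
  have T0: "\<And>y. y \<in> \<Omega> \<Longrightarrow> T 0 y = y"
    and T': "\<And>y t. y \<in> \<Omega> \<Longrightarrow> \<bar>t\<bar> < \<delta> \<Longrightarrow> ((\<lambda>s. T s y) has_vector_derivative v (T t y)) (at t)"
    using flow(2) unfolding is_flow_def by blast+
  define A where "A = (\<lambda>t. jacobian v (at (T t x)))"
  define J where "J = (\<lambda>t. jacobian (T t) (at x))"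
  obtain D where D: "((\<lambda>y. jacobian v (at y)) has_derivative D) (at x)"
    using d2v unfolding differentiable_def by blast
  have "(grad \<mu> has_derivative (\<lambda>h. jacobian v (at x) *v h)) (at x)"
  proof (rule has_derivative_transform_within_open[OF _ U xU])
    show "(v has_derivative (\<lambda>h. jacobian v (at x) *v h)) (at x)"
      using dv[OF xU] by (simp add: jacobian_works)
    show "v y = grad \<mu> y" if "y \<in> U" for y using grad_eqI[OF pot[OF that]] by simp
  qed
  then have Hx: "H = jacobian v (at x)" unfolding H_def hessian_def by (rule jacobian_eqI)
  have H0: "A 0 = H" using T0[OF \<Omega>(3)] by (simp add: A_def Hx)
  have symH: "transpose H = H"
    unfolding Hx using jacobian_of_gradient_symmetric[OF U xU pot dv[OF xU]] .
  have K: "K = 2 *\<^sub>R (D (v x) + H ** H)"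
    unfolding K_def Hx by (rule hessian_norm_gradient_squared[OF U xU pot dv D])
  have DK: "D (v x) = (1/2) *\<^sub>R K - H ** H" by (simp add: K)
  have "((\<lambda>t. jacobian v (at (T t x))) has_derivative (\<lambda>s. D (s *\<^sub>R v (T 0 x)))) (at 0)"
  proof (rule has_derivative_compose[of "\<lambda>t. T t x" "\<lambda>s. s *\<^sub>R v (T 0 x)" 0 UNIV "\<lambda>y. jacobian v (at y)" D])
    show "((\<lambda>t. T t x) has_derivative (\<lambda>s. s *\<^sub>R v (T 0 x))) (at 0)"
      using T'[OF \<Omega>(3), of 0] flow(1) by (simp add: has_vector_derivative_def)
    show "((\<lambda>y. jacobian v (at y)) has_derivative D) (at (T 0 x))"
      using D T0[OF \<Omega>(3)] by simp
  qed
  then have derA: "(A has_vector_derivative D (v x)) (at 0)"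
    using T0[OF \<Omega>(3)] linear_scale[OF has_derivative_linear[OF D]]
    by (simp add: has_vector_derivative_def A_def)
  obtain \<tau> where \<tau>: "\<tau> > 0" and J0: "J 0 = mat 1" and Tx: "\<And>t. \<bar>t\<bar> < \<tau> \<Longrightarrow> T t x \<in> \<Omega>"
    and J': "\<And>t i j. \<bar>t\<bar> < \<tau> \<Longrightarrow> ((\<lambda>s. J s $ i $ j) has_real_derivative (A t ** J t) $ i $ j) (at t)"
    using flow_jacobian_variation[OF \<Omega>(1,3) flow(1) dv lip T0 T'] \<Omega>(2) unfolding A_def J_def by blast
  have symA: "transpose (A t) = A t" if "\<bar>t\<bar> < \<tau>" for t
    unfolding A_def using Tx[OF that] \<Omega>(2) by (intro jacobian_of_gradient_symmetric[OF U _ pot dv]) auto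
  have Jac: "Jac T t x = det (J t)" for t by (simp add: Jac_def J_def)
  have q: "q = (\<lambda>t. bil (matrix_inv (J t) ** transpose (matrix_inv (J t))) \<xi> \<xi> * det (J t))"
    unfolding q_def Jac Qmat_def J_def ..
  note V = transported_densities_derivatives(1,2)[where J = J and A = A, OF \<tau> J0 J' symA derA, folded Jac, unfolded H0]
    transported_densities_derivatives(3,4)[where J = J and A = A and \<xi> = \<xi>, OF \<tau> J0 J' symA derA, folded q, unfolded H0]
  have trD: "trace (D (v x)) = trace K / 2 - frob H H"
    unfolding DK trace_square_symmetric[OF symH, symmetric]
    by (simp add: trace_def sum_subtractf sum_divide_distrib)
  have HH: "\<xi> \<bullet> ((H ** H) *v \<xi>) = (H *v \<xi>) \<bullet> (H *v \<xi>)"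
    using inner_matrix_vector_symmetric[OF symH, of \<xi> "H *v \<xi>"] by (simp add: matrix_vector_mul_assoc)
  have bil_simps: "bil (M + N) \<xi> \<xi> = bil M \<xi> \<xi> + bil N \<xi> \<xi>" "bil (M - N) \<xi> \<xi> = bil M \<xi> \<xi> - bil N \<xi> \<xi>"
    "bil (c *\<^sub>R M) \<xi> \<xi> = c * bil M \<xi> \<xi>" "bil (mat 1) \<xi> \<xi> = \<xi> \<bullet> \<xi>" for M N :: "real^'n^'n" and c
    by (simp_all add: bil_def matrix_vector_mult_add_rdistrib matrix_vector_mult_diff_rdistrib
        inner_add_right inner_diff_right scaleR_matrix_vector_assoc[symmetric])
  have DKbil: "\<xi> \<bullet> (D (v x) *v \<xi>) = bil K \<xi> \<xi> / 2 - (H *v \<xi>) \<bullet> (H *v \<xi>)"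
  proof -
    have "\<xi> \<bullet> (D (v x) *v \<xi>) = bil (D (v x)) \<xi> \<xi>" by (simp add: bil_def)
    also have "\<dots> = bil K \<xi> \<xi> / 2 - bil (H ** H) \<xi> \<xi>" unfolding DK bil_simps by simp
    also have "bil (H ** H) \<xi> \<xi> = (H *v \<xi>) \<bullet> (H *v \<xi>)" unfolding bil_def by (rule HH)
    finally show ?thesis .
  qed
  show "deriv (\<lambda>t. Jac T t x) 0 = trace H" by (rule V(1))
  show "(deriv ^^ 2) (\<lambda>t. Jac T t x) 0 = (trace H)\<^sup>2 + trace K / 2 - frob H H"
    using V(2) trD by simp
  show "deriv q 0 = bil (- 2 *\<^sub>R H + trace H *\<^sub>R mat 1) \<xi> \<xi>"
    using V(3) unfolding bil_simps by (simp add: bil_def)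
  show "(deriv ^^ 2) q 0 = bil (6 *\<^sub>R (H ** H) - K - (4 * trace H) *\<^sub>R H
                   + ((trace H)\<^sup>2 + trace K / 2 - frob H H) *\<^sub>R mat 1) \<xi> \<xi>"
    using V(4) unfolding bil_simps trD DKbil by (simp add: bil_def HH algebra_simps)
qed

theorem theorem6:
  fixes \<Omega> \<gamma>\<^sub>0 \<gamma>\<^sub>1 U :: "(real^'n) set"
    and \<mu> :: "real^'n \<Rightarrow> real" and v :: "real^'n \<Rightarrow> real^'n"
    and T :: "real \<Rightarrow> real^'n \<Rightarrow> real^'n" and \<delta> :: real
    and lam :: "nat \<Rightarrow> real" and u :: "nat \<Rightarrow> real^'n \<Rightarrow> real" and k :: nat
    and \<phi> :: "real^'n \<Rightarrow> real" and H K :: "real^'n \<Rightarrow> real^'n^'n"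
  assumes dim: "CARD('n) \<ge> 2"
    and dom: "bounded_lipschitz_domain \<Omega>"
    and rel_open: "openin (top_of_set (frontier \<Omega>)) \<gamma>\<^sub>0" "openin (top_of_set (frontier \<Omega>)) \<gamma>\<^sub>1"
    and disj: "\<gamma>\<^sub>0 \<inter> \<gamma>\<^sub>1 = {}"
    and cover: "closure \<gamma>\<^sub>0 \<union> closure \<gamma>\<^sub>1 = frontier \<Omega>"
    and sep: "closure \<gamma>\<^sub>0 \<inter> closure \<gamma>\<^sub>1 = {}"
    and nbhd: "open U" "closure \<Omega> \<subseteq> U"
    and potential: "\<And>x. x \<in> U \<Longrightarrow> GDERIV \<mu> x :> v x"
    and regular: "C11_on U v"
    and flow: "\<delta> > 0" "is_flow v U \<Omega> \<delta> T"
    and eigen: "eigen_system \<Omega> \<gamma>\<^sub>0 T 0 lam u"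
    and simple: "k \<ge> 1" "k \<ge> 2 \<Longrightarrow> lam (k - 1) < lam k" "lam k < lam (k + 1)"
    and phi: "\<phi> = u k"
    and HK: "H = hessian \<mu>" "K = hessian (\<lambda>x. (norm (grad \<mu> x))\<^sup>2)"
  shows "A_dot \<Omega> T \<phi> \<phi> =
           (LINT x|lebesgue_on \<Omega>.
              bil (- 2 *\<^sub>R H x + trace (H x) *\<^sub>R mat 1) (weak_grad \<Omega> \<phi> x) (weak_grad \<Omega> \<phi> x)) \<and>
         A_ddot \<Omega> T \<phi> \<phi> =
           (LINT x|lebesgue_on \<Omega>.
              bil (6 *\<^sub>R (H x ** H x) - K x - (4 * trace (H x)) *\<^sub>R H x
                   + ((trace (H x))\<^sup>2 + trace (K x) / 2 - frob (H x) (H x)) *\<^sub>R mat 1)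
                (weak_grad \<Omega> \<phi> x) (weak_grad \<Omega> \<phi> x)) \<and>
         B_dot \<Omega> T \<phi> \<phi> = (LINT x|lebesgue_on \<Omega>. trace (H x) * (\<phi> x)\<^sup>2) \<and>
         B_ddot \<Omega> T \<phi> \<phi> =
           (LINT x|lebesgue_on \<Omega>.
              ((trace (H x))\<^sup>2 + trace (K x) / 2 - frob (H x) (H x)) * (\<phi> x)\<^sup>2)"
proof -
  have \<Omega>: "open \<Omega>" "\<Omega> \<subseteq> U"
    using dom nbhd(2) closure_subset by (auto simp: bounded_lipschitz_domain_def)
  have pot: "(\<mu> has_derivative (\<lambda>h. v y \<bullet> h)) (at y)" if "y \<in> U" for y
    using potential[OF that] by (simp add: gderiv_def inner_commute)
  have dv: "v differentiable (at y)" if "y \<in> U" for y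
  proof -
    have "v differentiable (at y within U)"
      using regular that by (simp add: C11_on_def differentiable_on_def)
    then show ?thesis using at_within_open[OF that nbhd(1)] by simp
  qed
  have lip: "\<exists>e>0. \<exists>L. L-lipschitz_on (ball y e) (\<lambda>z. jacobian v (at z))" if "y \<in> U" for y
  proof -
    have "\<forall>x\<in>U. \<exists>e>0. \<exists>L. ball x e \<subseteq> U \<and> L-lipschitz_on (ball x e) (\<lambda>y. jacobian v (at y))"
      using regular unfolding C11_on_def by (rule conjunct2)
    with that show ?thesis by blast
  qed
  have meas: "\<Omega> \<in> sets lebesgue" using \<Omega>(1) by auto
  have "negligible {x \<in> U. \<not> (\<lambda>y. jacobian v (at y)) differentiable (at x)}"
    by (rule Rademacher[OF lip])
  then have "AE x in lebesgue. x \<notin> {x \<in> U. \<not> (\<lambda>y. jacobian v (at y)) differentiable (at x)}"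
    unfolding negligible_iff_null_sets by (rule AE_not_in)
  then have diff: "AE x in lebesgue_on \<Omega>. x \<in> \<Omega> \<and> (\<lambda>y. jacobian v (at y)) differentiable (at x)"
    using meas \<Omega>(2) by (auto simp: AE_restrict_space_iff elim!: eventually_mono)
  have ae: "AE x in lebesgue_on \<Omega>.
      deriv (\<lambda>t. Jac T t x) 0 = trace (H x) \<and>
      (deriv ^^ 2) (\<lambda>t. Jac T t x) 0 = (trace (H x))\<^sup>2 + trace (K x) / 2 - frob (H x) (H x) \<and>
      (\<forall>\<xi>. deriv (\<lambda>t. bil (Qmat T t x) \<xi> \<xi> * Jac T t x) 0 = bil (- 2 *\<^sub>R H x + trace (H x) *\<^sub>R mat 1) \<xi> \<xi> \<and>
        (deriv ^^ 2) (\<lambda>t. bil (Qmat T t x) \<xi> \<xi> * Jac T t x) 0 =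
          bil (6 *\<^sub>R (H x ** H x) - K x - (4 * trace (H x)) *\<^sub>R H x
             + ((trace (H x))\<^sup>2 + trace (K x) / 2 - frob (H x) (H x)) *\<^sub>R mat 1) \<xi> \<xi>)"
    using diff
  proof eventually_elim
    case (elim x)
    then obtain e L where e: "e > 0" "L-lipschitz_on (ball x e) (\<lambda>z. jacobian v (at z))"
      using lip \<Omega>(2) by blast
    note variation = pointwise_variation[OF nbhd(1) \<Omega> conjunct1[OF elim] pot dv e conjunct2[OF elim] flow,
        folded HK]
    show ?case
      by (intro conjI allI variation)
  qed
  show ?thesis
    unfolding A_dot_def A_ddot_def B_dot_def B_ddot_def A_dens_def
    by (intro conjI; rule lebesgue_on_integral_cong_AE[OF meas]; use ae in eventually_elim)
      (simp_all only: power2_eq_square mult.commute)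
qed

end
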